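(* Let $\theta,\mu,\lambda$ be infinite cardinals, let $\langle \mathbf{B}_i:i<\theta\rangle$ be a sequence of Boolean algebras, let $D$ be an ultrafilter on $\theta$, and let $\mathbf{B}=\prod_{i<\theta}\mathbf{B}_i/D$ be the ultraproduct. Assume: (a) $\theta<\mu<\lambda$; (b) $\mu$ is a compact cardinal; (c) $\operatorname{Depth}(\mathbf{B}_i)\le\lambda$ for every $i<\theta$; (d) $D$ is a uniform ultrafilter on $\theta$; (e) $\operatorname{Depth}(\mathbf{B})>\lambda+\left|\prod_{i<\theta}\operatorname{Depth}(\mathbf{B}_i)/D\right|$. Then $\operatorname{Depth}(\mathbf{B})=\lambda^{+}$ and $\left|\prod_{i<\theta}\operatorname{Depth}(\mathbf{B}_i)/D\right|=\lambda$.
   Context: For a Boolean algebra $\mathbf{B}$, $\operatorname{Depth}(\mathbf{B})=\sup\{\tau:\text{ there is } A\subseteq\mathbf{B}\text{ with }|A|=\tau\text{ such that } A\text{ is well ordered by }<_{\mathbf{B}}\}$. "Compact cardinal" means (uncountable) strongly compact cardinal. An ultrafilter on $\theta$ is uniform if all its members have cardinality $\theta$. $\prod_{i<\theta}\operatorname{Depth}(\mathbf{B}_i)/D$ is the ultraproduct of the cardinals $\operatorname{Depth}(\mathbf{B}_i)$, viewed as sets. *)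

theory Defs
  imports "HOL-Algebra.Lattice"
begin

unbundle cardinal_syntax

section \<open>Boolean algebras and their depth\<close>

locale boolean_lattice = bounded_lattice +
  assumes distrib:
    "\<lbrakk> x \<in> carrier L; y \<in> carrier L; z \<in> carrier L \<rbrakk> \<Longrightarrow> x \<sqinter> (y \<squnion> z) = (x \<sqinter> y) \<squnion> (x \<sqinter> z)"
    and complement_exists:
    "x \<in> carrier L \<Longrightarrow> \<exists>y \<in> carrier L. x \<squnion> y = \<top> \<and> x \<sqinter> y = \<bottom>"

definition well_ordered_in :: "('a, 'c) gorder_scheme \<Rightarrow> 'a set \<Rightarrow> bool" where
  "well_ordered_in L A \<longleftrightarrow>
     A \<subseteq> carrier L \<and> well_order_on A {(x, y). x \<in> A \<and> y \<in> A \<and> x \<sqsubseteq>\<^bsub>L\<^esub> y}"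

text \<open>
  \<open>Depth L\<close> is a cardinal (a minimal well-order in the sense of \<open>Card_order\<close>), determined up
  to \<open>=o\<close>. It suffices to look for upper bounds among the relations on \<open>'a\<close>: the cardinals that
  occur in the supremum are bounded by the cardinality of \<open>carrier L\<close>, and every cardinal below
  it is represented on \<open>'a\<close>. See \<open>Depth_upper\<close> and \<open>Depth_least\<close>.
\<close>

definition Depth :: "('a, 'c) gorder_scheme \<Rightarrow> 'a rel" where
  "Depth L = (SOME r. Card_order r \<and> (\<forall>A. well_ordered_in L A \<longrightarrow> |A| \<le>o r) \<and>
     (\<forall>r' :: 'a rel. Card_order r' \<and> (\<forall>A. well_ordered_in L A \<longrightarrow> |A| \<le>o r') \<longrightarrow> r \<le>o r'))"

lemma Depth_some:
  fixes L :: "('a, 'c) gorder_scheme"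
  shows "Card_order (Depth L) \<and> (\<forall>A. well_ordered_in L A \<longrightarrow> |A| \<le>o Depth L) \<and>
     (\<forall>r' :: 'a rel. Card_order r' \<and> (\<forall>A. well_ordered_in L A \<longrightarrow> |A| \<le>o r') \<longrightarrow> Depth L \<le>o r')"
proof -
  let ?R = "{r :: 'a rel. Card_order r \<and> (\<forall>A. well_ordered_in L A \<longrightarrow> |A| \<le>o r)}"
  have "|carrier L| \<in> ?R"
    by (auto simp: card_of_Card_order well_ordered_in_def intro: card_of_mono1)
  then have "?R \<noteq> {}" "\<forall>r\<in>?R. Card_order r" by blast+
  then have "\<exists>r\<in>?R. \<forall>r'\<in>?R. r \<le>o r'" by (rule exists_minim_Card_order)
  then have "\<exists>r :: 'a rel. Card_order r \<and> (\<forall>A. well_ordered_in L A \<longrightarrow> |A| \<le>o r) \<and>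
     (\<forall>r' :: 'a rel. Card_order r' \<and> (\<forall>A. well_ordered_in L A \<longrightarrow> |A| \<le>o r') \<longrightarrow> r \<le>o r')"
    by blast
  then show ?thesis unfolding Depth_def by (rule someI_ex)
qed

lemma Card_order_Depth: "Card_order (Depth L)"
  using Depth_some by blast

lemma Depth_upper: "well_ordered_in L A \<Longrightarrow> |A| \<le>o Depth L"
  using Depth_some by blast

lemma Depth_least:
  fixes r :: "'b rel"
  assumes r: "Card_order r" and ub: "\<And>A. well_ordered_in L A \<Longrightarrow> |A| \<le>o r"
  shows "Depth L \<le>o r"
proof (rule ccontr)
  assume "\<not> Depth L \<le>o r"
  then have less: "r <o Depth L"
    using Card_order_Depth[of L] r not_ordLeq_iff_ordLess by (auto simp: card_order_on_def)
  then have "|Field r| \<le>o |Field (Depth L)|"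
    by (intro card_of_mono2 ordLess_imp_ordLeq)
  then obtain f where f: "inj_on f (Field r)" "f ` Field r \<subseteq> Field (Depth L)"
    unfolding card_of_ordLeq[symmetric] by blast
  have iso: "r =o |f ` Field r|"
    using card_of_Field_ordIso[OF r] f(1) card_of_ordIso[of "Field r" "f ` Field r"]
    by (meson inj_on_imp_bij_betw ordIso_symmetric ordIso_transitive)
  have "Depth L \<le>o |f ` Field r|"
    using Depth_some[of L] ub iso card_of_Card_order ordLeq_ordIso_trans by blast
  then have "Depth L \<le>o r" using iso ordIso_symmetric ordLeq_ordIso_trans by blast
  then show False using less not_ordLess_ordLeq by blast
qed

section \<open>Filters on a set and strongly compact cardinals\<close>

definition filter_on :: "'a set \<Rightarrow> 'a set set \<Rightarrow> bool" where
  "filter_on S F \<longleftrightarrow> F \<subseteq> Pow S \<and> S \<in> F \<and> {} \<notin> F \<and>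
     (\<forall>A\<in>F. \<forall>B\<in>F. A \<inter> B \<in> F) \<and> (\<forall>A\<in>F. \<forall>B. A \<subseteq> B \<and> B \<subseteq> S \<longrightarrow> B \<in> F)"

definition ultrafilter_on :: "'a set \<Rightarrow> 'a set set \<Rightarrow> bool" where
  "ultrafilter_on S U \<longleftrightarrow> filter_on S U \<and> (\<forall>A. A \<subseteq> S \<longrightarrow> A \<in> U \<or> S - A \<in> U)"

definition uniform_on :: "'a set \<Rightarrow> 'a set set \<Rightarrow> bool" where
  "uniform_on S U \<longleftrightarrow> (\<forall>A\<in>U. |A| =o |S| )"

definition complete_family :: "'k rel \<Rightarrow> 'a set set \<Rightarrow> bool" where
  "complete_family \<kappa> F \<longleftrightarrow> (\<forall>X. X \<subseteq> F \<and> X \<noteq> {} \<and> |X| <o \<kappa> \<longrightarrow> \<Inter>X \<in> F)"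

text \<open>
  A cardinal is strongly compact if it is uncountable and regular and every \<open>\<kappa>\<close>-complete filter
  on any set \<open>S\<close> extends to a \<open>\<kappa>\<close>-complete ultrafilter on \<open>S\<close>. Since a formula cannot quantify
  over types, \<open>S\<close> ranges over all sets of elements of a type that is a parameter here.
\<close>

definition strongly_compact :: "'s itself \<Rightarrow> 'k rel \<Rightarrow> bool" where
  "strongly_compact (_ :: 's itself) \<kappa> \<longleftrightarrow>
     Card_order \<kappa> \<and> natLeq <o \<kappa> \<and> regularCard \<kappa> \<and>
     (\<forall>(S :: 's set) F. filter_on S F \<and> complete_family \<kappa> F \<longrightarrow>
        (\<exists>U. F \<subseteq> U \<and> ultrafilter_on S U \<and> complete_family \<kappa> U))"

section \<open>Ultraproducts\<close>

definition ultra_rel :: "'i set \<Rightarrow> 'i set set \<Rightarrow> ('i \<Rightarrow> 'a set) \<Rightarrow> ('i \<Rightarrow> 'a) rel" where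
  "ultra_rel I D X =
     {(f, g). f \<in> Pi\<^sub>E I X \<and> g \<in> Pi\<^sub>E I X \<and> {i \<in> I. f i = g i} \<in> D}"

definition ultraproduct_set ::
  "'i set \<Rightarrow> 'i set set \<Rightarrow> ('i \<Rightarrow> 'a set) \<Rightarrow> ('i \<Rightarrow> 'a) set set" where
  "ultraproduct_set I D X = Pi\<^sub>E I X // ultra_rel I D X"

text \<open>
  The ultraproduct of the ordered structures \<open>L i\<close>. The Boolean operations are derived from the
  order, and those of the ultraproduct are the ones induced by the coordinatewise operations: see
  \<open>ultraproduct_join\<close>, \<open>ultraproduct_meet\<close>, \<open>ultraproduct_top\<close>, \<open>ultraproduct_bottom\<close> and
  \<open>boolean_lattice_ultraproduct\<close>.
\<close>

definition ultraproduct ::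
  "'i set \<Rightarrow> 'i set set \<Rightarrow> ('i \<Rightarrow> 'a gorder) \<Rightarrow> ('i \<Rightarrow> 'a) set gorder" where
  "ultraproduct I D L =
     \<lparr> carrier = ultraproduct_set I D (\<lambda>i. carrier (L i)),
       eq = (=),
       le = (\<lambda>F G. \<exists>f\<in>F. \<exists>g\<in>G. {i \<in> I. f i \<sqsubseteq>\<^bsub>L i\<^esub> g i} \<in> D) \<rparr>"

lemma filter_on_mono:
  assumes "filter_on I D" "{i \<in> I. P i} \<in> D" "\<And>i. i \<in> I \<Longrightarrow> P i \<Longrightarrow> Q i"
  shows "{i \<in> I. Q i} \<in> D"
proof -
  have "{i \<in> I. P i} \<subseteq> {i \<in> I. Q i}" "{i \<in> I. Q i} \<subseteq> I" using assms(3) by auto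
  then show ?thesis using assms(1,2) unfolding filter_on_def by blast
qed

lemma filter_on_conj:
  assumes "filter_on I D" "{i \<in> I. P i} \<in> D" "{i \<in> I. Q i} \<in> D"
  shows "{i \<in> I. P i \<and> Q i} \<in> D"
proof -
  have "{i \<in> I. P i \<and> Q i} = {i \<in> I. P i} \<inter> {i \<in> I. Q i}" by auto
  then show ?thesis using assms unfolding filter_on_def by metis
qed

lemma filter_on_all:
  assumes "filter_on I D" "\<And>i. i \<in> I \<Longrightarrow> P i"
  shows "{i \<in> I. P i} \<in> D"
proof -
  have "{i \<in> I. P i} = I" using assms(2) by auto
  then show ?thesis using assms(1) unfolding filter_on_def by metis
qed

lemma equiv_ultra_rel:
  assumes D: "filter_on I D"
  shows "equiv (Pi\<^sub>E I X) (ultra_rel I D X)"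
proof (rule equivI)
  show "ultra_rel I D X \<subseteq> Pi\<^sub>E I X \<times> Pi\<^sub>E I X" by (auto simp: ultra_rel_def)
  show "refl_on (Pi\<^sub>E I X) (ultra_rel I D X)"
    using filter_on_all[OF D, of "\<lambda>_. True"] by (auto simp: refl_on_def ultra_rel_def)
  show "sym (ultra_rel I D X)"
    by (auto simp: sym_def ultra_rel_def eq_commute)
  show "trans (ultra_rel I D X)"
  proof (rule transI)
    fix f g h assume *: "(f, g) \<in> ultra_rel I D X" "(g, h) \<in> ultra_rel I D X"
    then have "{i \<in> I. f i = g i \<and> g i = h i} \<in> D"
      by (intro filter_on_conj[OF D]) (auto simp: ultra_rel_def)
    then have "{i \<in> I. f i = h i} \<in> D" by (rule filter_on_mono[OF D]) auto
    then show "(f, h) \<in> ultra_rel I D X" using * by (auto simp: ultra_rel_def)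
  qed
qed

context
  fixes I :: "'i set" and D :: "'i set set" and L :: "'i \<Rightarrow> 'a gorder"
  assumes D: "filter_on I D"
    and BL: "\<And>i. i \<in> I \<Longrightarrow> boolean_lattice (L i)"
begin

private abbreviation "R \<equiv> ultra_rel I D (\<lambda>i. carrier (L i))"
private abbreviation "P \<equiv> Pi\<^sub>E I (\<lambda>i. carrier (L i))"
private abbreviation "U \<equiv> ultraproduct I D L"
private abbreviation "cls f \<equiv> R `` {f}"

private lemma carr: "carrier U = {cls f |f. f \<in> P}"
  by (auto simp: ultraproduct_def ultraproduct_set_def quotient_def)

private lemma cls_carr: "f \<in> P \<Longrightarrow> cls f \<in> carrier U"
  by (auto simp: carr)

private lemma mem: "i \<in> I \<Longrightarrow> f \<in> P \<Longrightarrow> f i \<in> carrier (L i)"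
  by auto

private lemma cls_eq:
  assumes "f \<in> P" "g \<in> P"
  shows "cls f = cls g \<longleftrightarrow> {i \<in> I. f i = g i} \<in> D"
  using eq_equiv_class_iff[OF equiv_ultra_rel[OF D] assms] assms by (simp add: ultra_rel_def)

private lemma cls_le:
  assumes "f \<in> P" "g \<in> P"
  shows "cls f \<sqsubseteq>\<^bsub>U\<^esub> cls g \<longleftrightarrow> {i \<in> I. f i \<sqsubseteq>\<^bsub>L i\<^esub> g i} \<in> D"
proof
  assume "cls f \<sqsubseteq>\<^bsub>U\<^esub> cls g"
  then obtain f' g' where *: "{i \<in> I. f i = f' i} \<in> D" "{i \<in> I. g i = g' i} \<in> D"
      "{i \<in> I. f' i \<sqsubseteq>\<^bsub>L i\<^esub> g' i} \<in> D"
    by (auto simp: ultraproduct_def ultra_rel_def)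
  show "{i \<in> I. f i \<sqsubseteq>\<^bsub>L i\<^esub> g i} \<in> D"
    by (rule filter_on_mono[OF D filter_on_conj[OF D *(1) filter_on_conj[OF D *(2,3)]]]) auto
next
  assume "{i \<in> I. f i \<sqsubseteq>\<^bsub>L i\<^esub> g i} \<in> D"
  moreover have "f \<in> cls f" "g \<in> cls g"
    using assms equiv_class_self[OF equiv_ultra_rel[OF D]] by metis+
  ultimately show "cls f \<sqsubseteq>\<^bsub>U\<^esub> cls g" by (auto simp: ultraproduct_def)
qed

private lemma jm_P:
  assumes "f \<in> P" "g \<in> P"
  shows "(\<lambda>i\<in>I. f i \<squnion>\<^bsub>L i\<^esub> g i) \<in> P" "(\<lambda>i\<in>I. f i \<sqinter>\<^bsub>L i\<^esub> g i) \<in> P"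
proof -
  have "f i \<squnion>\<^bsub>L i\<^esub> g i \<in> carrier (L i) \<and> f i \<sqinter>\<^bsub>L i\<^esub> g i \<in> carrier (L i)" if "i \<in> I" for i
  proof -
    interpret boolean_lattice "L i" using BL that .
    show ?thesis using mem[OF that] assms by simp
  qed
  then show "(\<lambda>i\<in>I. f i \<squnion>\<^bsub>L i\<^esub> g i) \<in> P" "(\<lambda>i\<in>I. f i \<sqinter>\<^bsub>L i\<^esub> g i) \<in> P" by auto
qed

private lemma tb_P: "(\<lambda>i\<in>I. \<top>\<^bsub>L i\<^esub>) \<in> P" "(\<lambda>i\<in>I. \<bottom>\<^bsub>L i\<^esub>) \<in> P"
proof -
  have "\<top>\<^bsub>L i\<^esub> \<in> carrier (L i) \<and> \<bottom>\<^bsub>L i\<^esub> \<in> carrier (L i)" if "i \<in> I" for i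
  proof -
    interpret boolean_lattice "L i" using BL that .
    show ?thesis by simp
  qed
  then show "(\<lambda>i\<in>I. \<top>\<^bsub>L i\<^esub>) \<in> P" "(\<lambda>i\<in>I. \<bottom>\<^bsub>L i\<^esub>) \<in> P" by auto
qed

private lemma po_U: "partial_order U"
proof (unfold_locales, goal_cases)
  case (5 x y)
  then obtain f g where *: "x = cls f" "y = cls g" "f \<in> P" "g \<in> P" by (auto simp: carr)
  have "{i \<in> I. f i \<sqsubseteq>\<^bsub>L i\<^esub> g i \<and> g i \<sqsubseteq>\<^bsub>L i\<^esub> f i} \<in> D"
    using 5 * by (intro filter_on_conj[OF D]) (auto simp: cls_le)
  then have "{i \<in> I. f i = g i} \<in> D"
  proof (rule filter_on_mono[OF D], goal_cases)
    case (1 i)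
    interpret boolean_lattice "L i" using BL 1(1) .
    show ?case using 1 mem *(3,4) by (auto intro: le_antisym)
  qed
  then show ?case using * by (simp add: cls_eq ultraproduct_def)
next
  case (4 x)
  then obtain f where *: "x = cls f" "f \<in> P" by (auto simp: carr)
  have "{i \<in> I. f i \<sqsubseteq>\<^bsub>L i\<^esub> f i} \<in> D"
  proof (rule filter_on_all[OF D])
    fix i assume i: "i \<in> I"
    interpret boolean_lattice "L i" using BL i .
    show "f i \<sqsubseteq>\<^bsub>L i\<^esub> f i" using mem i * by auto
  qed
  then show ?case using * by (simp add: cls_le)
next
  case (6 x y z)
  then obtain f g h where *: "x = cls f" "y = cls g" "z = cls h" "f \<in> P" "g \<in> P" "h \<in> P"
    by (auto simp: carr)
  have "{i \<in> I. f i \<sqsubseteq>\<^bsub>L i\<^esub> g i \<and> g i \<sqsubseteq>\<^bsub>L i\<^esub> h i} \<in> D"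
    using 6 * by (intro filter_on_conj[OF D]) (auto simp: cls_le)
  then have "{i \<in> I. f i \<sqsubseteq>\<^bsub>L i\<^esub> h i} \<in> D"
  proof (rule filter_on_mono[OF D], goal_cases)
    case (1 i)
    interpret boolean_lattice "L i" using BL 1(1) .
    show ?case using 1 mem *(4-6) le_trans[of "f i" "g i" "h i"] by auto
  qed
  then show ?case using * by (simp add: cls_le)
qed (auto simp: ultraproduct_def)

private lemma ultra_join_least:
  assumes fg: "f \<in> P" "g \<in> P"
  shows "least U (cls (\<lambda>i\<in>I. f i \<squnion>\<^bsub>L i\<^esub> g i)) (Upper U {cls f, cls g})"
proof (rule least_UpperI)
  fix x assume x: "x \<in> {cls f, cls g}"
  have ae: "{i \<in> I. f i \<sqsubseteq>\<^bsub>L i\<^esub> (\<lambda>i\<in>I. f i \<squnion>\<^bsub>L i\<^esub> g i) i \<and>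
      g i \<sqsubseteq>\<^bsub>L i\<^esub> (\<lambda>i\<in>I. f i \<squnion>\<^bsub>L i\<^esub> g i) i} \<in> D"
  proof (rule filter_on_all[OF D])
    fix i assume i: "i \<in> I"
    interpret boolean_lattice "L i" using BL i .
    show "f i \<sqsubseteq>\<^bsub>L i\<^esub> (\<lambda>i\<in>I. f i \<squnion>\<^bsub>L i\<^esub> g i) i \<and> g i \<sqsubseteq>\<^bsub>L i\<^esub> (\<lambda>i\<in>I. f i \<squnion>\<^bsub>L i\<^esub> g i) i"
      using mem[OF i] fg i join_left join_right by simp
  qed
  have "cls f \<sqsubseteq>\<^bsub>U\<^esub> cls (\<lambda>i\<in>I. f i \<squnion>\<^bsub>L i\<^esub> g i)" "cls g \<sqsubseteq>\<^bsub>U\<^esub> cls (\<lambda>i\<in>I. f i \<squnion>\<^bsub>L i\<^esub> g i)"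
    unfolding cls_le[OF fg(1) jm_P(1)[OF fg]] cls_le[OF fg(2) jm_P(1)[OF fg]]
    by (rule filter_on_mono[OF D ae], blast)+
  then show "x \<sqsubseteq>\<^bsub>U\<^esub> cls (\<lambda>i\<in>I. f i \<squnion>\<^bsub>L i\<^esub> g i)" using x by blast
next
  fix y assume y: "y \<in> Upper U {cls f, cls g}"
  have "y \<in> carrier U" using y by (simp add: Upper_def)
  then obtain h where h: "y = cls h" "h \<in> P" by (auto simp: carr)
  have "cls f \<sqsubseteq>\<^bsub>U\<^esub> y" "cls g \<sqsubseteq>\<^bsub>U\<^esub> y" using y fg cls_carr by (auto simp: Upper_def)
  then have "{i \<in> I. f i \<sqsubseteq>\<^bsub>L i\<^esub> h i \<and> g i \<sqsubseteq>\<^bsub>L i\<^esub> h i} \<in> D"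
    using fg h by (intro filter_on_conj[OF D]) (auto simp: cls_le)
  then have "{i \<in> I. (\<lambda>i\<in>I. f i \<squnion>\<^bsub>L i\<^esub> g i) i \<sqsubseteq>\<^bsub>L i\<^esub> h i} \<in> D"
  proof (rule filter_on_mono[OF D], goal_cases)
    case (1 i)
    interpret boolean_lattice "L i" using BL 1(1) .
    show ?case using 1 mem fg h by (simp add: join_le)
  qed
  then show "cls (\<lambda>i\<in>I. f i \<squnion>\<^bsub>L i\<^esub> g i) \<sqsubseteq>\<^bsub>U\<^esub> y" using h jm_P[OF fg] by (simp add: cls_le)
qed (use fg jm_P[OF fg] cls_carr in auto)

private lemma ultra_meet_greatest:
  assumes fg: "f \<in> P" "g \<in> P"
  shows "greatest U (cls (\<lambda>i\<in>I. f i \<sqinter>\<^bsub>L i\<^esub> g i)) (Lower U {cls f, cls g})"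
proof (rule greatest_LowerI)
  fix x assume x: "x \<in> {cls f, cls g}"
  have ae: "{i \<in> I. (\<lambda>i\<in>I. f i \<sqinter>\<^bsub>L i\<^esub> g i) i \<sqsubseteq>\<^bsub>L i\<^esub> f i \<and>
      (\<lambda>i\<in>I. f i \<sqinter>\<^bsub>L i\<^esub> g i) i \<sqsubseteq>\<^bsub>L i\<^esub> g i} \<in> D"
  proof (rule filter_on_all[OF D])
    fix i assume i: "i \<in> I"
    interpret boolean_lattice "L i" using BL i .
    show "(\<lambda>i\<in>I. f i \<sqinter>\<^bsub>L i\<^esub> g i) i \<sqsubseteq>\<^bsub>L i\<^esub> f i \<and> (\<lambda>i\<in>I. f i \<sqinter>\<^bsub>L i\<^esub> g i) i \<sqsubseteq>\<^bsub>L i\<^esub> g i"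
      using mem[OF i] fg i meet_left meet_right by simp
  qed
  have "cls (\<lambda>i\<in>I. f i \<sqinter>\<^bsub>L i\<^esub> g i) \<sqsubseteq>\<^bsub>U\<^esub> cls f" "cls (\<lambda>i\<in>I. f i \<sqinter>\<^bsub>L i\<^esub> g i) \<sqsubseteq>\<^bsub>U\<^esub> cls g"
    unfolding cls_le[OF jm_P(2)[OF fg] fg(1)] cls_le[OF jm_P(2)[OF fg] fg(2)]
    by (rule filter_on_mono[OF D ae], blast)+
  then show "cls (\<lambda>i\<in>I. f i \<sqinter>\<^bsub>L i\<^esub> g i) \<sqsubseteq>\<^bsub>U\<^esub> x" using x by blast
next
  fix y assume y: "y \<in> Lower U {cls f, cls g}"
  have "y \<in> carrier U" using y by (simp add: Lower_def)
  then obtain h where h: "y = cls h" "h \<in> P" by (auto simp: carr)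
  have "y \<sqsubseteq>\<^bsub>U\<^esub> cls f" "y \<sqsubseteq>\<^bsub>U\<^esub> cls g" using y fg cls_carr by (auto simp: Lower_def)
  then have "{i \<in> I. h i \<sqsubseteq>\<^bsub>L i\<^esub> f i \<and> h i \<sqsubseteq>\<^bsub>L i\<^esub> g i} \<in> D"
    using fg h by (intro filter_on_conj[OF D]) (auto simp: cls_le)
  then have "{i \<in> I. h i \<sqsubseteq>\<^bsub>L i\<^esub> (\<lambda>i\<in>I. f i \<sqinter>\<^bsub>L i\<^esub> g i) i} \<in> D"
  proof (rule filter_on_mono[OF D], goal_cases)
    case (1 i)
    interpret boolean_lattice "L i" using BL 1(1) .
    show ?case using 1 mem fg h by (simp add: meet_le)
  qed
  then show "y \<sqsubseteq>\<^bsub>U\<^esub> cls (\<lambda>i\<in>I. f i \<sqinter>\<^bsub>L i\<^esub> g i)" using h jm_P[OF fg] by (simp add: cls_le)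
qed (use fg jm_P[OF fg] cls_carr in auto)

private lemma ultra_top_greatest: "greatest U (cls (\<lambda>i\<in>I. \<top>\<^bsub>L i\<^esub>)) (carrier U)"
proof -
  have "cls f \<sqsubseteq>\<^bsub>U\<^esub> cls (\<lambda>i\<in>I. \<top>\<^bsub>L i\<^esub>)" if f: "f \<in> P" for f
  proof -
    have "{i \<in> I. f i \<sqsubseteq>\<^bsub>L i\<^esub> (\<lambda>i\<in>I. \<top>\<^bsub>L i\<^esub>) i} \<in> D"
    proof (rule filter_on_all[OF D])
      fix i assume i: "i \<in> I"
      interpret boolean_lattice "L i" using BL i .
      show "f i \<sqsubseteq>\<^bsub>L i\<^esub> (\<lambda>i\<in>I. \<top>\<^bsub>L i\<^esub>) i" using mem[OF i f] i top_higher by simp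
    qed
    then show ?thesis using f tb_P by (simp add: cls_le)
  qed
  then show ?thesis using tb_P cls_carr by (auto simp: greatest_def carr)
qed

private lemma ultra_bottom_least: "least U (cls (\<lambda>i\<in>I. \<bottom>\<^bsub>L i\<^esub>)) (carrier U)"
proof -
  have "cls (\<lambda>i\<in>I. \<bottom>\<^bsub>L i\<^esub>) \<sqsubseteq>\<^bsub>U\<^esub> cls f" if f: "f \<in> P" for f
  proof -
    have "{i \<in> I. (\<lambda>i\<in>I. \<bottom>\<^bsub>L i\<^esub>) i \<sqsubseteq>\<^bsub>L i\<^esub> f i} \<in> D"
    proof (rule filter_on_all[OF D])
      fix i assume i: "i \<in> I"
      interpret boolean_lattice "L i" using BL i .
      show "(\<lambda>i\<in>I. \<bottom>\<^bsub>L i\<^esub>) i \<sqsubseteq>\<^bsub>L i\<^esub> f i" using mem[OF i f] i bottom_lower by simp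
    qed
    then show ?thesis using f tb_P by (simp add: cls_le)
  qed
  then show ?thesis using tb_P cls_carr by (auto simp: least_def carr)
qed

private lemma bounded_U: "bounded_lattice U"
proof -
  interpret partial_order U by (rule po_U)
  show ?thesis
  proof (unfold_locales, goal_cases)
    case (1 x y)
    then obtain f g where "x = cls f" "y = cls g" "f \<in> P" "g \<in> P" by (auto simp: carr)
    then show ?case using ultra_join_least by blast
  next
    case (2 x y)
    then obtain f g where "x = cls f" "y = cls g" "f \<in> P" "g \<in> P" by (auto simp: carr)
    then show ?case using ultra_meet_greatest by blast
  qed (use ultra_top_greatest ultra_bottom_least in blast)+
qed

lemma ultraproduct_join:
  assumes "f \<in> P" "g \<in> P"
  shows "cls f \<squnion>\<^bsub>U\<^esub> cls g = cls (\<lambda>i\<in>I. f i \<squnion>\<^bsub>L i\<^esub> g i)"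
proof -
  interpret bounded_lattice U by (rule bounded_U)
  show ?thesis
    unfolding join_def[of U]
    by (rule least_unique[OF sup_of_two_least ultra_join_least]) (intro cls_carr assms)+
qed

lemma ultraproduct_meet:
  assumes "f \<in> P" "g \<in> P"
  shows "cls f \<sqinter>\<^bsub>U\<^esub> cls g = cls (\<lambda>i\<in>I. f i \<sqinter>\<^bsub>L i\<^esub> g i)"
proof -
  interpret bounded_lattice U by (rule bounded_U)
  show ?thesis
    unfolding meet_def[of U]
    by (rule greatest_unique[OF inf_of_two_greatest ultra_meet_greatest]) (intro cls_carr assms)+
qed

lemma ultraproduct_top: "\<top>\<^bsub>U\<^esub> = cls (\<lambda>i\<in>I. \<top>\<^bsub>L i\<^esub>)"
proof -
  interpret bounded_lattice U by (rule bounded_U)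
  show ?thesis by (rule greatest_unique[OF top_greatest ultra_top_greatest])
qed

lemma ultraproduct_bottom: "\<bottom>\<^bsub>U\<^esub> = cls (\<lambda>i\<in>I. \<bottom>\<^bsub>L i\<^esub>)"
proof -
  interpret bounded_lattice U by (rule bounded_U)
  show ?thesis by (rule least_unique[OF bottom_least ultra_bottom_least])
qed

lemma boolean_lattice_ultraproduct: "boolean_lattice U"
proof -
  interpret bounded_lattice U by (rule bounded_U)
  show ?thesis
  proof (unfold_locales, goal_cases)
    case (1 x y z)
    then obtain f g h where *: "x = cls f" "y = cls g" "z = cls h" "f \<in> P" "g \<in> P" "h \<in> P"
      by (auto simp: carr)
    have "(\<lambda>i\<in>I. f i \<sqinter>\<^bsub>L i\<^esub> (\<lambda>i\<in>I. g i \<squnion>\<^bsub>L i\<^esub> h i) i) =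
      (\<lambda>i\<in>I. (\<lambda>i\<in>I. f i \<sqinter>\<^bsub>L i\<^esub> g i) i \<squnion>\<^bsub>L i\<^esub> (\<lambda>i\<in>I. f i \<sqinter>\<^bsub>L i\<^esub> h i) i)"
    proof (rule restrict_ext)
      fix i assume i: "i \<in> I"
      interpret boolean_lattice "L i" using BL i .
      show "f i \<sqinter>\<^bsub>L i\<^esub> (\<lambda>i\<in>I. g i \<squnion>\<^bsub>L i\<^esub> h i) i = (\<lambda>i\<in>I. f i \<sqinter>\<^bsub>L i\<^esub> g i) i \<squnion>\<^bsub>L i\<^esub> (\<lambda>i\<in>I. f i \<sqinter>\<^bsub>L i\<^esub> h i) i"
        using mem[OF i] * i distrib by simp
    qed
    then show ?case
      unfolding *(1-3) ultraproduct_join[OF *(5,6)] ultraproduct_meet[OF *(4,5)]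
        ultraproduct_meet[OF *(4,6)] ultraproduct_meet[OF *(4) jm_P(1)[OF *(5,6)]]
        ultraproduct_join[OF jm_P(2)[OF *(4,5)] jm_P(2)[OF *(4,6)]]
      by (rule arg_cong)
  next
    case (2 x)
    then obtain f where *: "x = cls f" "f \<in> P" by (auto simp: carr)
    have "\<forall>i\<in>I. \<exists>y. y \<in> carrier (L i) \<and> f i \<squnion>\<^bsub>L i\<^esub> y = \<top>\<^bsub>L i\<^esub> \<and> f i \<sqinter>\<^bsub>L i\<^esub> y = \<bottom>\<^bsub>L i\<^esub>"
    proof
      fix i assume i: "i \<in> I"
      show "\<exists>y. y \<in> carrier (L i) \<and> f i \<squnion>\<^bsub>L i\<^esub> y = \<top>\<^bsub>L i\<^esub> \<and> f i \<sqinter>\<^bsub>L i\<^esub> y = \<bottom>\<^bsub>L i\<^esub>"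
        using boolean_lattice.complement_exists[OF BL[OF i] mem[OF i *(2)]] by blast
    qed
    from bchoice[OF this] obtain c where c: "\<And>i. i \<in> I \<Longrightarrow> c i \<in> carrier (L i) \<and> f i \<squnion>\<^bsub>L i\<^esub> c i = \<top>\<^bsub>L i\<^esub> \<and>
        f i \<sqinter>\<^bsub>L i\<^esub> c i = \<bottom>\<^bsub>L i\<^esub>"
      by blast
    define g where "g = restrict c I"
    have g: "g \<in> P" using c by (auto simp: g_def)
    have "(\<lambda>i\<in>I. f i \<squnion>\<^bsub>L i\<^esub> g i) = (\<lambda>i\<in>I. \<top>\<^bsub>L i\<^esub>)" "(\<lambda>i\<in>I. f i \<sqinter>\<^bsub>L i\<^esub> g i) = (\<lambda>i\<in>I. \<bottom>\<^bsub>L i\<^esub>)"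
      using c by (auto simp: g_def intro!: restrict_ext)
    then have "x \<squnion>\<^bsub>U\<^esub> cls g = \<top>\<^bsub>U\<^esub>" "x \<sqinter>\<^bsub>U\<^esub> cls g = \<bottom>\<^bsub>U\<^esub>"
      unfolding *(1) ultraproduct_join[OF *(2) g] ultraproduct_meet[OF *(2) g]
        ultraproduct_top ultraproduct_bottom
      by simp_all
    then show ?case using cls_carr[OF g] by blast
  qed
qed

end

end

theory Submission
  imports Defs
begin

text \<open>
  Let \<open>\<mu> \<le> \<chi>\<close> and let \<open>Depth (B i) \<le> \<chi>\<close> for \<open>D\<close>-almost all \<open>i\<close>. The key fact is that the
  ultraproduct then has no chain of length \<open>\<kappa> = \<chi>\<^sup>+\<^sup>+\<close>. Such a chain yields transitive relations
  \<open>R i\<close> on \<open>\<kappa>\<close> such that \<open>{i. R i a b} \<in> D\<close> for all \<open>a < b\<close>. Take a fine \<open>\<mu>\<close>-complete ultrafilter on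
  the subsets of \<open>\<kappa>\<close> of size less than \<open>\<mu>\<close> and the least function \<open>f\<close> that exceeds all constants
  modulo it. As \<open>\<chi>\<^sup>+\<close> has only \<open>\<chi>\<^sup>+\<close> subsets of size less than \<open>\<mu>\<close> (Solovay), almost every \<open>f x\<close>
  reflects the types over small bounded sets, and so there is a cofinal small end-homogeneous set
  \<open>H x\<close> below \<open>f x\<close>. By minimality of \<open>f\<close> the sets \<open>H x\<close> interleave with \<open>\<kappa>\<close> many constants,
  and for some \<open>i\<close> this makes \<open>\<kappa>\<close> many constants an \<open>R i\<close>-chain, which contradicts the bound on the
  depth of \<open>B i\<close>.

  With \<open>\<chi> = \<lambda>\<close> this gives \<open>Depth (\<Prod>B i / D) \<le> \<lambda>\<^sup>+\<close>. If the ultraproduct of the depths had cardinality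
  \<open>\<pi> < \<lambda>\<close>, then \<open>Depth (B i) \<le> max \<pi> \<mu>\<close> almost everywhere, and \<open>\<chi> = max \<pi> \<mu>\<close> would give
  \<open>Depth (\<Prod>B i / D) \<le> \<lambda>\<close>.
\<close>

section \<open>Regular cardinals as well-orders\<close>

text \<open>Zorn's lemma. \<open>P\<close> need not be symmetric: a clique tests both orders of a
  pair, so maximality is stated with \<open>P a c\<close> and \<open>P c a\<close>. It yields both
  the spaced sets and the end-homogeneous sets below.\<close>

lemma maximal_clique:
  obtains S where "S \<subseteq> X" "\<forall>a\<in>S. \<forall>b\<in>S. a \<noteq> b \<longrightarrow> P a b"
    "\<forall>c\<in>X. (\<forall>a\<in>S. a \<noteq> c \<longrightarrow> P a c \<and> P c a) \<longrightarrow> c \<in> S"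
proof -
  let ?A = "{S. S \<subseteq> X \<and> (\<forall>a\<in>S. \<forall>b\<in>S. a \<noteq> b \<longrightarrow> P a b)}"
  have "\<exists>M\<in>?A. \<forall>Y\<in>?A. M \<subseteq> Y \<longrightarrow> Y = M"
  proof (rule subset_Zorn')
    fix C assume "subset.chain ?A C"
    then have C: "C \<subseteq> ?A" "\<And>Y Z. Y \<in> C \<Longrightarrow> Z \<in> C \<Longrightarrow> Y \<subseteq> Z \<or> Z \<subseteq> Y"
      by (auto simp: subset_chain_def)
    have "P a b" if ab: "a \<in> \<Union>C" "b \<in> \<Union>C" "a \<noteq> b" for a b
    proof -
      obtain Y Z where "Y \<in> C" "Z \<in> C" "a \<in> Y" "b \<in> Z" using ab by blast
      then obtain V where "V \<in> C" "a \<in> V" "b \<in> V" using C(2)[of Y Z] by blast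
      then show ?thesis using C(1) ab(3) by blast
    qed
    then show "\<Union>C \<in> ?A" using C(1) by blast
  qed
  then obtain S where S': "S \<in> ?A" and max: "\<forall>Y\<in>?A. S \<subseteq> Y \<longrightarrow> Y = S" ..
  then have S: "S \<subseteq> X" "\<forall>a\<in>S. \<forall>b\<in>S. a \<noteq> b \<longrightarrow> P a b" by auto
  have "c \<in> S" if "c \<in> X" "\<forall>a\<in>S. a \<noteq> c \<longrightarrow> P a c \<and> P c a" for c
  proof -
    have "insert c S \<in> ?A" using S that by auto
    then have "insert c S = S" using bspec[OF max, of "insert c S"] by blast
    then show "c \<in> S" by blast
  qed
  then show thesis using that[of S] S by blast
qed

locale regular_cardinal =
  fixes r :: "'a rel"
  assumes Cinf: "Cinfinite r" and reg: "regularCard r"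
begin

definition less :: "'a \<Rightarrow> 'a \<Rightarrow> bool" (infix \<open>\<prec>\<close> 50) where
  "a \<prec> b \<longleftrightarrow> a \<noteq> b \<and> (a, b) \<in> r"

definition leq :: "'a \<Rightarrow> 'a \<Rightarrow> bool" (infix \<open>\<preceq>\<close> 50) where
  "a \<preceq> b \<longleftrightarrow> (a, b) \<in> r"

lemma Card: "Card_order r" and inf: "\<not> finite (Field r)"
  using Cinf by (auto simp: cinfinite_def)

lemma Well: "Well_order r"
  using Card by (simp add: card_order_on_def)

lemma lin: "trans r" "antisym r" "total_on (Field r) r" "refl_on (Field r) r" "wf (r - Id)"
  using Well by (auto simp: well_order_on_def linear_order_on_def partial_order_on_def preorder_on_def)

lemma less_Field: "a \<prec> b \<Longrightarrow> a \<in> Field r" "a \<prec> b \<Longrightarrow> b \<in> Field r"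
  by (auto simp: less_def Field_def)

lemma leq_Field: "a \<preceq> b \<Longrightarrow> a \<in> Field r" "a \<preceq> b \<Longrightarrow> b \<in> Field r"
  by (auto simp: leq_def Field_def)

lemma less_imp_leq: "a \<prec> b \<Longrightarrow> a \<preceq> b"
  by (simp add: less_def leq_def)

lemma less_irrefl: "\<not> a \<prec> a"
  by (simp add: less_def)

lemma leq_refl: "a \<in> Field r \<Longrightarrow> a \<preceq> a"
  using lin(4) by (auto simp: leq_def refl_on_def)

lemma leq_trans: "a \<preceq> b \<Longrightarrow> b \<preceq> c \<Longrightarrow> a \<preceq> c"
  using lin(1) unfolding leq_def trans_def by blast

lemma less_leq_trans: "a \<prec> b \<Longrightarrow> b \<preceq> c \<Longrightarrow> a \<prec> c"
  using lin(1,2) unfolding less_def leq_def trans_def antisym_def by blast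

lemma leq_less_trans: "a \<preceq> b \<Longrightarrow> b \<prec> c \<Longrightarrow> a \<prec> c"
  using lin(1,2) unfolding less_def leq_def trans_def antisym_def by blast

lemma less_trans: "a \<prec> b \<Longrightarrow> b \<prec> c \<Longrightarrow> a \<prec> c"
  using less_leq_trans less_imp_leq by blast

lemma not_less: "a \<in> Field r \<Longrightarrow> b \<in> Field r \<Longrightarrow> \<not> a \<prec> b \<longleftrightarrow> b \<preceq> a"
  using antisymD[OF lin(2), of a b] lin(3) leq_refl
  by (cases "a = b") (auto simp: less_def leq_def total_on_def)

lemma less_linear: "a \<in> Field r \<Longrightarrow> b \<in> Field r \<Longrightarrow> a \<noteq> b \<Longrightarrow> a \<prec> b \<or> b \<prec> a"
  using lin(3) unfolding less_def total_on_def by blast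

lemma inj_on_if_less:
  assumes "A \<subseteq> Field r" "\<And>a b. a \<in> A \<Longrightarrow> b \<in> A \<Longrightarrow> a \<prec> b \<Longrightarrow> w a \<noteq> w b"
  shows "inj_on w A"
proof (rule inj_onI, rule ccontr)
  fix a b assume ab: "a \<in> A" "b \<in> A" "w a = w b" "a \<noteq> b"
  then have "a \<prec> b \<or> b \<prec> a" using less_linear assms(1) by (auto dest: subsetD)
  then show False
  proof
    assume "a \<prec> b"
    then show False using assms(2)[OF ab(1,2)] ab(3) by simp
  next
    assume "b \<prec> a"
    then show False using assms(2)[OF ab(2,1)] ab(3) by simp
  qed
qed

lemma leq_cases: "a \<preceq> b \<Longrightarrow> a = b \<or> a \<prec> b"
  by (auto simp: less_def leq_def)

lemma least_element:
  assumes "x \<in> A"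
  obtains a where "a \<in> A" "\<And>b. b \<in> A \<Longrightarrow> \<not> b \<prec> a"
proof -
  obtain z where "z \<in> A" "\<And>y. (y, z) \<in> r - Id \<Longrightarrow> y \<notin> A"
    using wfE_min[OF lin(5) assms] by blast
  then show thesis by (intro that[of z]) (auto simp: less_def)
qed

lemma no_descent: "\<not> (\<forall>n::nat. h (Suc n) \<prec> h n)"
  using lin(5) unfolding wf_iff_no_infinite_down_chain less_def by blast

lemma greater_exists: "a \<in> Field r \<Longrightarrow> \<exists>b. a \<prec> b"
  using infinite_Card_order_limit[OF Card inf] by (auto simp: less_def)

lemma upper_bound2:
  assumes "a \<in> Field r" "b \<in> Field r"
  shows "\<exists>c. a \<prec> c \<and> b \<prec> c"
proof (cases "a \<prec> b")
  case True
  then show ?thesis using greater_exists[OF assms(2)] less_trans by blast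
next
  case False
  then show ?thesis
    using greater_exists[OF assms(1)] not_less[OF assms] leq_less_trans by blast
qed

lemma small_bounded:
  assumes "X \<subseteq> Field r" "|X| <o r"
  shows "\<exists>b \<in> Field r. \<forall>x\<in>X. x \<prec> b"
proof -
  have "\<not> cofinal X r"
    using reg assms not_ordLess_ordIso unfolding regularCard_def by blast
  then obtain a where a: "a \<in> Field r" "\<forall>x\<in>X. \<not> a \<prec> x"
    by (auto simp: cofinal_def less_def)
  obtain b where b: "a \<prec> b" using greater_exists a(1) by blast
  have "x \<prec> b" if "x \<in> X" for x
    using a that assms(1) b leq_less_trans not_less by blast
  then show ?thesis using less_Field(2)[OF b] by blast
qed

lemma unbounded_card:
  assumes "S \<subseteq> Field r" "\<And>a. a \<in> Field r \<Longrightarrow> \<exists>b\<in>S. a \<prec> b"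
  shows "|S| =o r"
  using reg assms by (auto simp: regularCard_def cofinal_def less_def)

lemma card_below: "a \<in> Field r \<Longrightarrow> |{b. b \<prec> a}| <o r"
  using card_of_underS[OF Card] by (simp add: underS_def less_def)

lemma card_below_eq: "a \<in> Field r \<Longrightarrow> |{b. b \<preceq> a}| <o r"
proof -
  assume a: "a \<in> Field r"
  obtain c where c: "a \<prec> c" using greater_exists[OF a] by blast
  have "{b. b \<preceq> a} \<subseteq> {b. b \<prec> c}" using c leq_less_trans by blast
  then show ?thesis
    using card_below[OF less_Field(2)[OF c]] card_of_mono1 ordLeq_ordLess_trans by blast
qed

lemma bounded_image:
  assumes "a \<in> Field r" "\<And>b. b \<preceq> a \<Longrightarrow> g b \<in> Field r"
  shows "\<exists>c \<in> Field r. \<forall>b. b \<preceq> a \<longrightarrow> g b \<prec> c"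
proof -
  have "|g ` {b. b \<preceq> a}| <o r"
    using card_of_image ordLeq_ordLess_trans card_below_eq[OF assms(1)] by blast
  then show ?thesis using small_bounded[of "g ` {b. b \<preceq> a}"] assms(2) by blast
qed

text \<open>A maximal \<open>s\<close>-spaced set is unbounded: if \<open>a\<close> bounded it, then
  the values of \<open>s\<close> up to \<open>a\<close> would be bounded by regularity, and a point
  beyond \<open>a\<close> and this bound could be added. Being unbounded, it has full size, again by
  regularity.\<close>

lemma spaced_subset:
  assumes s: "\<And>a. a \<in> Field r \<Longrightarrow> s a \<in> Field r"
  obtains S where "S \<subseteq> Field r" "|S| =o r" "\<And>a b. a \<in> S \<Longrightarrow> b \<in> S \<Longrightarrow> a \<prec> b \<Longrightarrow> s a \<preceq> b"
proof -
  obtain S where S: "S \<subseteq> Field r"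
    and cl: "\<forall>a\<in>S. \<forall>b\<in>S. a \<noteq> b \<longrightarrow> a \<prec> b \<longrightarrow> s a \<preceq> b"
    and max: "\<forall>c\<in>Field r.
      (\<forall>a\<in>S. a \<noteq> c \<longrightarrow> (a \<prec> c \<longrightarrow> s a \<preceq> c) \<and> (c \<prec> a \<longrightarrow> s c \<preceq> a)) \<longrightarrow> c \<in> S"
    using maximal_clique[of "Field r" "\<lambda>a b. a \<prec> b \<longrightarrow> s a \<preceq> b"] .
  have "\<exists>b\<in>S. a \<prec> b" if a: "a \<in> Field r" for a
  proof (rule ccontr)
    assume none: "\<not> (\<exists>b\<in>S. a \<prec> b)"
    then have le: "b \<preceq> a" if "b \<in> S" for b using a S not_less that by blast
    obtain c where c: "c \<in> Field r" "\<And>b. b \<preceq> a \<Longrightarrow> s b \<prec> c"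
      using bounded_image[of a s] a s leq_Field by blast
    obtain d where d: "a \<prec> d" "c \<prec> d" using upper_bound2 a c(1) by blast
    have "(b \<prec> d \<longrightarrow> s b \<preceq> d) \<and> (d \<prec> b \<longrightarrow> s d \<preceq> b)" if "b \<in> S" for b
    proof
      show "b \<prec> d \<longrightarrow> s b \<preceq> d" using le[OF that] c(2) d(2) less_imp_leq less_trans by blast
      have "\<not> d \<prec> b"
        using leq_less_trans[OF le[OF that] d(1)] less_trans[of d b d] less_irrefl[of d] by blast
      then show "d \<prec> b \<longrightarrow> s d \<preceq> b" by blast
    qed
    then have "d \<in> S" using max less_Field(2)[OF d(1)] by blast
    then show False using none d(1) by blast
  qed
  then have "|S| =o r" by (rule unbounded_card[OF S])
  moreover have "s a \<preceq> b" if "a \<in> S" "b \<in> S" "a \<prec> b" for a b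
    using cl that less_irrefl[of a] by (cases "a = b") auto
  ultimately show thesis using that[OF S] by blast
qed

end

section \<open>Complete ultrafilters\<close>

locale complete_ultrafilter =
  fixes \<mu> :: "'k rel" and J :: "'j set" and U :: "'j set set"
  assumes ultra: "ultrafilter_on J U" and complete: "complete_family \<mu> U"
    and uncountable: "natLeq <o \<mu>"
begin

definition ae :: "('j \<Rightarrow> bool) \<Rightarrow> bool" where
  "ae P \<longleftrightarrow> {x \<in> J. P x} \<in> U"

lemma filter: "filter_on J U"
  using ultra by (simp add: ultrafilter_on_def)

lemma ae_mono: "ae P \<Longrightarrow> (\<And>x. x \<in> J \<Longrightarrow> P x \<Longrightarrow> Q x) \<Longrightarrow> ae Q"
  unfolding ae_def by (rule filter_on_mono[OF filter])

lemma ae_conj: "ae P \<Longrightarrow> ae Q \<Longrightarrow> ae (\<lambda>x. P x \<and> Q x)"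
  unfolding ae_def by (rule filter_on_conj[OF filter])

lemma ae_all: "(\<And>x. x \<in> J \<Longrightarrow> P x) \<Longrightarrow> ae P"
  unfolding ae_def by (rule filter_on_all[OF filter])

lemma ae_ex: "ae P \<Longrightarrow> \<exists>x\<in>J. P x"
proof -
  assume "ae P"
  then have "{x \<in> J. P x} \<noteq> {}" using filter unfolding ae_def filter_on_def by metis
  then show ?thesis by blast
qed

lemma ae_not: "\<not> ae P \<longleftrightarrow> ae (\<lambda>x. \<not> P x)"
proof
  assume "\<not> ae P"
  moreover have "J - {x \<in> J. P x} = {x \<in> J. \<not> P x}" by blast
  moreover have "{x \<in> J. P x} \<in> U \<or> J - {x \<in> J. P x} \<in> U"
    using ultra Collect_subset[of J P] by (auto simp: ultrafilter_on_def)
  ultimately show "ae (\<lambda>x. \<not> P x)" by (auto simp: ae_def)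
next
  assume "ae (\<lambda>x. \<not> P x)"
  then show "\<not> ae P" using ae_conj[of P "\<lambda>x. \<not> P x"] ae_ex by blast
qed

lemma ae_ball:
  assumes "|Z| <o \<mu>" "\<And>z. z \<in> Z \<Longrightarrow> ae (P z)"
  shows "ae (\<lambda>x. \<forall>z\<in>Z. P z x)"
proof (cases "Z = {}")
  case True
  then show ?thesis by (auto intro: ae_all)
next
  case False
  let ?X = "(\<lambda>z. {x \<in> J. P z x}) ` Z"
  have "|?X| <o \<mu>" using assms(1) card_of_image ordLeq_ordLess_trans by blast
  moreover have "?X \<subseteq> U" using assms(2) by (auto simp: ae_def)
  ultimately have "\<Inter>?X \<in> U" using False complete by (auto simp: complete_family_def)
  moreover have "\<Inter>?X = {x \<in> J. \<forall>z\<in>Z. P z x}" using False by auto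
  ultimately show ?thesis by (simp add: ae_def)
qed

text \<open>If no \<open>z\<close> worked almost everywhere, the fewer than \<mu> negations would
  hold simultaneously. This turns a witness that varies with the point into a fixed one.\<close>

lemma ae_bex:
  assumes "|Z| <o \<mu>" "ae (\<lambda>x. \<exists>z\<in>Z. P z x)"
  shows "\<exists>z\<in>Z. ae (P z)"
proof (rule ccontr)
  assume "\<not> (\<exists>z\<in>Z. ae (P z))"
  then have "ae (\<lambda>x. \<forall>z\<in>Z. \<not> P z x)" using ae_not by (intro ae_ball assms(1)) blast
  then show False using ae_conj[OF assms(2)] ae_ex by blast
qed

lemma ae_all_nat:
  assumes "\<And>n::nat. ae (P n)"
  shows "ae (\<lambda>x. \<forall>n. P n x)"
proof -
  have "|UNIV :: nat set| <o \<mu>"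
    using uncountable card_of_nat ordIso_ordLess_trans by blast
  from ae_ball[OF this, of P] assms show ?thesis by simp
qed

end

section \<open>Weakly normal fine ultrafilters\<close>

text \<open>The extension property is separated from \<open>strongly_compact\<close> and its type
  parameter because it is needed at index sets whose elements have another type.\<close>

definition extends_complete_filters :: "'k rel \<Rightarrow> 'j set \<Rightarrow> bool" where
  "extends_complete_filters \<mu> J \<longleftrightarrow> (\<forall>F. filter_on J F \<and> complete_family \<mu> F \<longrightarrow>
     (\<exists>U. F \<subseteq> U \<and> ultrafilter_on J U \<and> complete_family \<mu> U))"

text \<open>The injection \<open>e\<close> carries the filter to the image of \<open>J\<close>,
  where strong compactness extends it; the subsets of \<open>J\<close> whose images lie in the
  extension form the wanted ultrafilter.\<close>

lemma strongly_compact_imp_extends: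
  fixes e :: "'j \<Rightarrow> 's"
  assumes sc: "strongly_compact TYPE('s) \<mu>" and inj: "inj_on e J"
  shows "extends_complete_filters \<mu> J"
  unfolding extends_complete_filters_def
proof (intro allI impI)
  fix F assume F: "filter_on J F \<and> complete_family \<mu> F"
  define p where "p B = {y \<in> J. e y \<in> B}" for B
  have pe: "p (e ` A) = A" if "A \<subseteq> J" for A
    using that inj by (auto simp: p_def inj_on_def)
  have ep: "e ` p B = B" if "B \<subseteq> e ` J" for B
    using that by (auto simp: p_def)
  have pJ: "p B \<subseteq> J" for B by (auto simp: p_def)
  define G where "G = {B. B \<subseteq> e ` J \<and> p B \<in> F}"
  have "filter_on (e ` J) G"
    unfolding filter_on_def
  proof (intro conjI ballI allI impI)
    show "e ` J \<in> G" "{} \<notin> G"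
      using F pe[of J] pe[of "{}"] by (auto simp: G_def filter_on_def p_def)
    show "A \<inter> B \<in> G" if "A \<in> G" "B \<in> G" for A B
    proof -
      have "p (A \<inter> B) = p A \<inter> p B" by (auto simp: p_def)
      then show ?thesis using that F by (auto simp: G_def filter_on_def)
    qed
    show "B \<in> G" if "A \<in> G" "A \<subseteq> B \<and> B \<subseteq> e ` J" for A B
    proof -
      have "p A \<subseteq> p B" using that by (auto simp: p_def)
      then show ?thesis using that F pJ[of B] by (auto simp: G_def filter_on_def)
    qed
  qed (auto simp: G_def)
  moreover have "complete_family \<mu> G"
    unfolding complete_family_def
  proof (intro allI impI)
    fix X assume X: "X \<subseteq> G \<and> X \<noteq> {} \<and> |X| <o \<mu>"
    have "|p ` X| <o \<mu>" using X card_of_image ordLeq_ordLess_trans by blast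
    moreover have "p ` X \<subseteq> F" using X by (auto simp: G_def)
    ultimately have "\<Inter>(p ` X) \<in> F" using F X by (simp add: complete_family_def)
    moreover have "\<Inter>(p ` X) = p (\<Inter>X)" using X by (auto simp: p_def)
    moreover have "\<Inter>X \<subseteq> e ` J" using X unfolding G_def by blast
    ultimately show "\<Inter>X \<in> G" by (simp add: G_def)
  qed
  ultimately obtain V where V: "G \<subseteq> V" "ultrafilter_on (e ` J) V" "complete_family \<mu> V"
    using sc unfolding strongly_compact_def by blast
  define U where "U = {A. A \<subseteq> J \<and> e ` A \<in> V}"
  have fV: "filter_on (e ` J) V" using V(2) by (simp add: ultrafilter_on_def)
  have "filter_on J U"
    unfolding filter_on_def
  proof (intro conjI ballI allI impI)
    show "J \<in> U" "{} \<notin> U" using fV by (auto simp: U_def filter_on_def)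
    show "A \<inter> B \<in> U" if "A \<in> U" "B \<in> U" for A B
    proof -
      have "e ` (A \<inter> B) = e ` A \<inter> e ` B"
        using that inj by (intro inj_on_image_Int) (auto simp: U_def)
      then show ?thesis using that fV by (auto simp: U_def filter_on_def)
    qed
    show "B \<in> U" if "A \<in> U" "A \<subseteq> B \<and> B \<subseteq> J" for A B
    proof -
      have "e ` A \<subseteq> e ` B" "e ` B \<subseteq> e ` J" using that by auto
      then have "e ` B \<in> V" using that fV unfolding U_def filter_on_def by blast
      then show ?thesis using that by (simp add: U_def)
    qed
  qed (auto simp: U_def)
  moreover have "A \<in> U \<or> J - A \<in> U" if "A \<subseteq> J" for A
  proof -
    have "e ` (J - A) = e ` J - e ` A" using that inj by (intro inj_on_image_set_diff) auto
    moreover have "e ` A \<subseteq> e ` J" using that by blast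
    ultimately have "e ` A \<in> V \<or> e ` (J - A) \<in> V" using V(2) by (simp add: ultrafilter_on_def)
    then show ?thesis using that unfolding U_def by blast
  qed
  ultimately have "ultrafilter_on J U" by (simp add: ultrafilter_on_def)
  moreover have "complete_family \<mu> U"
    unfolding complete_family_def
  proof (intro allI impI)
    fix X assume X: "X \<subseteq> U \<and> X \<noteq> {} \<and> |X| <o \<mu>"
    have "|(`) e ` X| <o \<mu>" using X card_of_image ordLeq_ordLess_trans by blast
    moreover have "(`) e ` X \<subseteq> V" using X by (auto simp: U_def)
    ultimately have "\<Inter>((`) e ` X) \<in> V" using V(3) X by (simp add: complete_family_def)
    moreover have "e ` \<Inter>X = \<Inter>((`) e ` X)"
    proof -
      obtain Y where "Y \<in> X" using X by blast
      then show ?thesis using image_INT[OF inj, of X "\<lambda>Y. Y" Y] X by (auto simp: U_def)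
    qed
    moreover have "\<Inter>X \<subseteq> J" using X unfolding U_def by blast
    ultimately show "\<Inter>X \<in> U" by (simp add: U_def)
  qed
  moreover have "F \<subseteq> U"
  proof
    fix A assume A: "A \<in> F"
    then have "A \<subseteq> J" using F by (auto simp: filter_on_def)
    then have "e ` A \<in> G" using A pe by (auto simp: G_def)
    then show "A \<in> U" using V(1) \<open>A \<subseteq> J\<close> by (auto simp: U_def)
  qed
  ultimately show "\<exists>U. F \<subseteq> U \<and> ultrafilter_on J U \<and> complete_family \<mu> U" by blast
qed

abbreviation small_subsets :: "'k rel \<Rightarrow> 'a set \<Rightarrow> 'a set set" where
  "small_subsets \<mu> A \<equiv> {x. x \<subseteq> A \<and> |x| <o \<mu>}"

text \<open>In the ultrapower of the well-order \<open>r\<close>, the function \<open>f\<close>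
  represents the supremum of the constants; \<open>regressive\<close> expresses its
  minimality.\<close>

locale weakly_normal = regular_cardinal r + complete_ultrafilter \<mu> "small_subsets \<mu> (Field r)" U
  for r :: "'a rel" and \<mu> :: "'k rel" and U +
  fixes f :: "'a set \<Rightarrow> 'a"
  assumes mu_leq: "\<mu> \<le>o r" and Cinf_mu: "Cinfinite \<mu>" and reg_mu: "regularCard \<mu>"
    and fine: "a \<in> Field r \<Longrightarrow> ae (\<lambda>x. a \<in> x)"
    and above: "a \<in> Field r \<Longrightarrow> ae (\<lambda>x. a \<prec> f x)"
    and regressive: "ae (\<lambda>x. h x \<prec> f x) \<Longrightarrow> \<exists>b\<in>Field r. ae (\<lambda>x. h x \<preceq> b)"

text \<open>The cones of small supersets of a small \<open>Z\<close> generate a filter. It is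
  \<mu>-complete because, by regularity, a union of fewer than \<mu> small sets is small. An
  ultrafilter extending it contains the cone over each singleton, which is fineness.\<close>

lemma fine_ultrafilter_exists:
  fixes \<mu> :: "'k rel" and A :: "'a set"
  assumes mu: "Cinfinite \<mu>" "regularCard \<mu>"
    and ext: "extends_complete_filters \<mu> (small_subsets \<mu> A)"
  obtains U where "ultrafilter_on (small_subsets \<mu> A) U" "complete_family \<mu> U"
    "\<forall>a\<in>A. {x \<in> small_subsets \<mu> A. a \<in> x} \<in> U"
proof -
  let ?J = "small_subsets \<mu> A"
  have Card: "Card_order \<mu>" and inf: "\<not> finite (Field \<mu>)"
    using mu(1) by (auto simp: cinfinite_def)
  have fin: "|Z| <o \<mu>" if "finite Z" for Z :: "'a set"
    using that finite_iff_ordLess_natLeq natLeq_ordLeq_cinfinite[OF mu(1)] ordLess_ordLeq_trans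
    by blast
  define F where "F = {Y. Y \<subseteq> ?J \<and> (\<exists>Z\<in>?J. {x \<in> ?J. Z \<subseteq> x} \<subseteq> Y)}"
  have FI: "Y \<in> F" if "Y \<subseteq> ?J" "Z \<in> ?J" "{x \<in> ?J. Z \<subseteq> x} \<subseteq> Y" for Y Z
    using that(1) bexI[where P = "\<lambda>Z. {x \<in> ?J. Z \<subseteq> x} \<subseteq> Y", OF that(3,2)]
    unfolding F_def by simp
  have FD: "Y \<subseteq> ?J" "\<exists>Z\<in>?J. {x \<in> ?J. Z \<subseteq> x} \<subseteq> Y" if "Y \<in> F" for Y
    using that unfolding F_def by simp_all
  have UN: "(\<Union>Y\<in>X. Z Y) \<in> ?J" if "|X| <o \<mu>" "\<And>Y. Y \<in> X \<Longrightarrow> Z Y \<in> ?J"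
    for X :: "'a set set set" and Z
    using that regularCard_UNION_bound[OF mu that(1), of Z] by auto
  have "filter_on ?J F"
    unfolding filter_on_def
  proof (intro conjI ballI allI impI)
    have "{} \<in> ?J" using fin[OF finite.emptyI] by blast
    then show "?J \<in> F" by (rule FI[rotated]) auto
    show "{} \<notin> F"
    proof
      assume "{} \<in> F"
      \<comment> \<open>\<open>Z\<close> belongs to its own cone, so no cone is empty.\<close>
      from FD(2)[OF this] obtain Z where "Z \<in> ?J" "{x \<in> ?J. Z \<subseteq> x} \<subseteq> {}" ..
      then show False by blast
    qed
    show "Y \<inter> Y' \<in> F" if "Y \<in> F" "Y' \<in> F" for Y Y'
    proof -
      have "\<exists>Z\<in>?J. {x \<in> ?J. Z \<subseteq> x} \<subseteq> Y" "\<exists>Z\<in>?J. {x \<in> ?J. Z \<subseteq> x} \<subseteq> Y'"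
        using that FD(2) by simp_all
      then obtain Z Z' where Z: "Z \<in> ?J" "{x \<in> ?J. Z \<subseteq> x} \<subseteq> Y" "Z' \<in> ?J" "{x \<in> ?J. Z' \<subseteq> x} \<subseteq> Y'"
        by (elim bexE)
      have "|Z \<union> Z'| <o \<mu>"
        using card_of_Un_ordLess_infinite_Field[OF inf Card] Z(1,3) by blast
      then have "Z \<union> Z' \<in> ?J" using Z(1,3) by blast
      moreover have "{x \<in> ?J. Z \<union> Z' \<subseteq> x} \<subseteq> Y \<inter> Y'" using Z(2,4) by blast
      moreover have "Y \<inter> Y' \<subseteq> ?J" using FD(1)[OF that(1)] by (rule le_infI1)
      ultimately show ?thesis by (rule FI[rotated])
    qed
    show "B \<in> F" if "Y \<in> F" "Y \<subseteq> B \<and> B \<subseteq> ?J" for Y B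
    proof -
      have "\<exists>Z\<in>?J. {x \<in> ?J. Z \<subseteq> x} \<subseteq> Y" using FD(2)[OF that(1)] .
      then obtain Z where Z: "Z \<in> ?J" "{x \<in> ?J. Z \<subseteq> x} \<subseteq> Y" by (elim bexE)
      show ?thesis using FI[OF conjunct2[OF that(2)] Z(1)] Z(2) that(2) by (meson order_trans)
    qed
  qed (auto simp: F_def)
  moreover have "complete_family \<mu> F"
    unfolding complete_family_def
  proof (intro allI impI)
    fix X assume X: "X \<subseteq> F \<and> X \<noteq> {} \<and> |X| <o \<mu>"
    have "\<forall>Y\<in>X. \<exists>Z. Z \<in> ?J \<and> {x \<in> ?J. Z \<subseteq> x} \<subseteq> Y"
    proof
      fix Y assume "Y \<in> X"
      then have "Y \<in> F" using X by (auto dest: subsetD)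
      from FD(2)[OF this] show "\<exists>Z. Z \<in> ?J \<and> {x \<in> ?J. Z \<subseteq> x} \<subseteq> Y" unfolding Bex_def .
    qed
    from bchoice[OF this] obtain Z where "\<forall>Y\<in>X. Z Y \<in> ?J \<and> {x \<in> ?J. Z Y \<subseteq> x} \<subseteq> Y" ..
    then have Z: "\<And>Y. Y \<in> X \<Longrightarrow> Z Y \<in> ?J" "\<And>Y. Y \<in> X \<Longrightarrow> {x \<in> ?J. Z Y \<subseteq> x} \<subseteq> Y"
      by simp_all
    obtain Y where "Y \<in> X" using X by blast
    moreover from this have "Y \<in> F" using X by (auto dest: subsetD)
    ultimately have "\<Inter>X \<subseteq> ?J" using FD(1)[of Y] by (meson Inter_lower order_trans)
    moreover have "(\<Union>Y\<in>X. Z Y) \<in> ?J" using conjunct2[OF conjunct2[OF X]] Z(1) by (rule UN)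
    moreover have "{x \<in> ?J. (\<Union>Y\<in>X. Z Y) \<subseteq> x} \<subseteq> \<Inter>X"
    proof
      fix x assume x: "x \<in> {x \<in> ?J. (\<Union>Y\<in>X. Z Y) \<subseteq> x}"
      have "x \<in> Y" if "Y \<in> X" for Y using Z(2)[OF that] x that by blast
      then show "x \<in> \<Inter>X" by blast
    qed
    ultimately show "\<Inter>X \<in> F" by (rule FI)
  qed
  ultimately obtain U where U: "F \<subseteq> U" "ultrafilter_on ?J U" "complete_family \<mu> U"
    using ext unfolding extends_complete_filters_def by blast
  have "{x \<in> ?J. a \<in> x} \<in> U" if "a \<in> A" for a
  proof -
    have "{a} \<in> ?J" using that fin[of "{a}"] by blast
    then have "{x \<in> ?J. a \<in> x} \<in> F" by (rule FI[rotated]) auto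
    then show ?thesis using U(1) by blast
  qed
  then show thesis using that[OF U(2,3)] by simp
qed

text \<open>
  Pushing a fine ultrafilter forward along the least function that exceeds all constants makes it
  weakly normal; countable completeness makes the ultrapower of the well-order \<open>r\<close> well-founded.
\<close>

lemma weakly_normal_exists:
  fixes r :: "'a rel" and \<mu> :: "'k rel"
  assumes r: "Cinfinite r" "regularCard r"
    and mu: "Cinfinite \<mu>" "regularCard \<mu>" "natLeq <o \<mu>" "\<mu> \<le>o r"
    and ext: "extends_complete_filters \<mu> (small_subsets \<mu> (Field r))"
  shows "\<exists>U f. weakly_normal r \<mu> U f"
proof -
  interpret regular_cardinal r using r by unfold_locales
  obtain U where U: "ultrafilter_on (small_subsets \<mu> (Field r)) U" "complete_family \<mu> U"
    "\<forall>a\<in>Field r. {x \<in> small_subsets \<mu> (Field r). a \<in> x} \<in> U"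
    using fine_ultrafilter_exists[OF mu(1,2) ext] .
  interpret complete_ultrafilter \<mu> "small_subsets \<mu> (Field r)" U
    using U(1,2) mu(3) by unfold_locales
  have fine: "ae (\<lambda>x. a \<in> x)" if "a \<in> Field r" for a
    using U(3) that by (simp add: ae_def)
  let ?R = "{(g, h). ae (\<lambda>x. g x \<prec> h x)}"
  have wf: "wf ?R"
    unfolding wf_iff_no_infinite_down_chain
  proof
    assume "\<exists>h. \<forall>n. (h (Suc n), h n) \<in> ?R"
    then obtain h where "\<And>n::nat. ae (\<lambda>x. h (Suc n) x \<prec> h n x)" by auto
    then have "ae (\<lambda>x. \<forall>n. h (Suc n) x \<prec> h n x)" by (rule ae_all_nat)
    then obtain x where "\<forall>n. h (Suc n) x \<prec> h n x" using ae_ex by blast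
    then show False using no_descent[of "\<lambda>n. h n x"] by blast
  qed
  \<comment> \<open>\<open>Q\<close> collects the functions lying above every constant. It is
    nonempty: a small set \<open>x\<close> has a strict upper bound by regularity, and this bound
    exceeds a fixed \<open>a\<close> whenever \<open>a \<in> x\<close>, hence almost everywhere by
    fineness.\<close>
  define Q where "Q = {h. \<forall>a\<in>Field r. ae (\<lambda>x. a \<prec> h x)}"
  define f0 where "f0 x = (SOME b. \<forall>a\<in>x. a \<prec> b)" for x
  have f0: "\<forall>a\<in>x. a \<prec> f0 x" if "x \<in> small_subsets \<mu> (Field r)" for x
  proof -
    have "\<exists>b. \<forall>a\<in>x. a \<prec> b"
      using small_bounded[of x] that mu(4) ordLess_ordLeq_trans by blast
    then show ?thesis unfolding f0_def by (rule someI_ex)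
  qed
  have "ae (\<lambda>x. a \<prec> f0 x)" if "a \<in> Field r" for a
    using fine[OF that] by (rule ae_mono) (use f0 in blast)
  then have "f0 \<in> Q" by (simp add: Q_def)
  from wfE_min[OF wf this] obtain f where f: "f \<in> Q" "\<And>h. (h, f) \<in> ?R \<Longrightarrow> h \<notin> Q" by blast
  have "weakly_normal r \<mu> U f"
  proof (unfold_locales)
    fix h assume h: "ae (\<lambda>x. h x \<prec> f x)"
    \<comment> \<open>Minimality of \<open>f\<close> in \<open>Q\<close>: whatever lies below
      \<open>f\<close> fails to exceed some constant.\<close>
    then have "h \<notin> Q" using f(2) by blast
    then obtain a where a: "a \<in> Field r" "\<not> ae (\<lambda>x. a \<prec> h x)" by (auto simp: Q_def)
    have "ae (\<lambda>x. \<not> a \<prec> h x \<and> h x \<prec> f x)" using a(2) ae_not h by (intro ae_conj) auto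
    then have "ae (\<lambda>x. h x \<preceq> a)"
      by (rule ae_mono) (use not_less a(1) less_Field(1) in blast)
    then show "\<exists>b\<in>Field r. ae (\<lambda>x. h x \<preceq> b)" using a(1) by blast
  qed (use f(1) mu fine in \<open>auto simp: Q_def\<close>)
  then show ?thesis by blast
qed

section \<open>Consequences of weak normality and the covering of small sets\<close>

context weakly_normal
begin

text \<open>Choosing \<open>y\<close> as a function of \<open>x\<close> produces a regressive
  function. \<open>P\<close> may depend on \<open>x\<close> itself and not only on
  \<open>f x\<close>.\<close>

lemma ex_regressive:
  assumes "ae (\<lambda>x. \<exists>y. y \<prec> f x \<and> P x y)"
  shows "\<exists>b\<in>Field r. ae (\<lambda>x. \<exists>y. y \<preceq> b \<and> y \<prec> f x \<and> P x y)"
proof -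
  define h where "h x = (SOME y. y \<prec> f x \<and> P x y)" for x
  have h: "ae (\<lambda>x. h x \<prec> f x \<and> P x (h x))"
    using assms by (rule ae_mono) (unfold h_def, rule someI_ex)
  then have "ae (\<lambda>x. h x \<prec> f x)" by (rule ae_mono) simp
  then obtain b where b: "b \<in> Field r" "ae (\<lambda>x. h x \<preceq> b)" using regressive by blast
  have "ae (\<lambda>x. \<exists>y. y \<preceq> b \<and> y \<prec> f x \<and> P x y)"
    using ae_conj[OF h b(2)] by (rule ae_mono) blast
  then show ?thesis using b(1) by blast
qed

definition cofinal_below :: "'a set \<Rightarrow> 'a \<Rightarrow> bool" where
  "cofinal_below x e \<longleftrightarrow> x \<subseteq> Field r \<and> |x| <o \<mu> \<and> (\<forall>a. a \<prec> e \<longrightarrow> (\<exists>w\<in>x. a \<prec> w \<and> w \<prec> e))"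

text \<open>Otherwise some \<open>a\<close> below \<open>f x\<close> has no element of
  \<open>x\<close> strictly between itself and \<open>f x\<close>. Such \<open>a\<close> are bounded
  by a constant \<open>b\<close>, and a constant \<open>c\<close> above \<open>b\<close> lies in
  \<open>x\<close> by fineness and below \<open>f x\<close>, which is a contradiction.\<close>

lemma ae_cofinal_below: "ae (\<lambda>x. cofinal_below x (f x))"
proof (rule ccontr)
  assume "\<not> ?thesis"
  then have "ae (\<lambda>x. \<not> cofinal_below x (f x))" by (simp add: ae_not)
  then have "ae (\<lambda>x. \<exists>a. a \<prec> f x \<and> (\<forall>w\<in>x. a \<prec> w \<longrightarrow> \<not> w \<prec> f x))"
    by (rule ae_mono) (auto simp: cofinal_below_def)
  from ex_regressive[OF this] obtain b where b: "b \<in> Field r"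
    "ae (\<lambda>x. \<exists>a. a \<preceq> b \<and> a \<prec> f x \<and> (\<forall>w\<in>x. a \<prec> w \<longrightarrow> \<not> w \<prec> f x))" by blast
  obtain c where c: "b \<prec> c" using greater_exists[OF b(1)] by blast
  have "ae (\<lambda>x. (\<exists>a. a \<preceq> b \<and> a \<prec> f x \<and> (\<forall>w\<in>x. a \<prec> w \<longrightarrow> \<not> w \<prec> f x)) \<and> c \<in> x \<and> c \<prec> f x)"
    using b(2) less_Field(2)[OF c] by (intro ae_conj fine above)
  from ae_ex[OF this] show False using c leq_less_trans by blast
qed

text \<open>Given an injection \<open>t\<close> of \<open>Field r\<close> into \<open>Pow T\<close>,
  \<mu>-completeness makes \<open>t (f x)\<close> equal to one set \<open>t0\<close> almost
  everywhere. So \<open>f\<close> would be constant almost everywhere, yet it exceeds every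
  constant.\<close>

lemma Pow_small:
  assumes T: "|T| <o \<mu>"
  shows "|Pow T| <o r"
proof (rule ccontr)
  assume "\<not> ?thesis"
  then have "|Field r| \<le>o |Pow T|"
    using Card card_of_Card_order card_of_Field_ordIso ordIso_ordLeq_trans not_ordLess_iff_ordLeq
    by (metis card_of_Well_order Well)
  then obtain t where t: "inj_on t (Field r)" "t ` Field r \<subseteq> Pow T"
    unfolding card_of_ordLeq[symmetric] by blast
  define t0 where "t0 = {z \<in> T. ae (\<lambda>x. z \<in> t (f x))}"
  have "ae (\<lambda>x. \<forall>z\<in>T. z \<in> t (f x) \<longleftrightarrow> z \<in> t0)"
  proof (rule ae_ball[OF T])
    fix z assume z: "z \<in> T"
    show "ae (\<lambda>x. z \<in> t (f x) \<longleftrightarrow> z \<in> t0)"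
    proof (cases "ae (\<lambda>x. z \<in> t (f x))")
      case True
      moreover from this have "z \<in> t0" using z by (simp add: t0_def)
      ultimately show ?thesis by simp
    next
      case False
      moreover from this have "z \<notin> t0" by (simp add: t0_def)
      ultimately show ?thesis using ae_not[of "\<lambda>x. z \<in> t (f x)"] by simp
    qed
  qed
  moreover obtain a where a: "a \<in> Field r" using inf by fastforce
  ultimately have ae1: "ae (\<lambda>x. (\<forall>z\<in>T. z \<in> t (f x) \<longleftrightarrow> z \<in> t0) \<and> a \<prec> f x)"
    using above by (intro ae_conj)
  have ae2: "ae (\<lambda>x. t (f x) = t0 \<and> f x \<in> Field r)"
    using ae1
  proof (rule ae_mono)
    fix x assume x: "(\<forall>z\<in>T. z \<in> t (f x) \<longleftrightarrow> z \<in> t0) \<and> a \<prec> f x"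
    then have f: "f x \<in> Field r" using less_Field(2) by blast
    then have "t (f x) \<subseteq> T" using t(2) by blast
    moreover have "t0 \<subseteq> T" by (auto simp: t0_def)
    ultimately show "t (f x) = t0 \<and> f x \<in> Field r" using x f by blast
  qed
  then obtain x where x: "t (f x) = t0" "f x \<in> Field r" using ae_ex by blast
  obtain y where "t (f y) = t0" "f y \<in> Field r" "f x \<prec> f y"
    using ae_ex[OF ae_conj[OF ae2 above[OF x(2)]]] by blast
  then show False using t(1) x less_irrefl by (metis inj_onD)
qed

text \<open>This is the core of Solovay's proof that a regular \<open>r\<close> has only \<open>r\<close> many subsets of size below \<open>\<mu>\<close>.\<close>

lemma small_cover:
  obtains W :: "'a \<Rightarrow> 'a set" where
    "\<forall>e\<in>Field r. |W e| <o \<mu>"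
    "\<forall>Z. Z \<subseteq> Field r \<and> |Z| <o \<mu> \<longrightarrow> (\<exists>e\<in>Field r. Z \<subseteq> W e)"
proof -
  \<comment> \<open>The chosen set depends on \<open>f x\<close> alone and not on \<open>x\<close>;
    this allows the covering family to be indexed by \<open>Field r\<close>.\<close>
  define c where "c e = (SOME x. cofinal_below x e)" for e
  have c: "ae (\<lambda>x. cofinal_below (c (f x)) (f x))"
    using ae_cofinal_below by (rule ae_mono) (unfold c_def, rule someI)
  have "\<exists>b\<in>Field r. ae (\<lambda>x. \<exists>w\<in>c (f x). a \<prec> w \<and> w \<preceq> b)" if a: "a \<in> Field r" for a
  proof -
    have "ae (\<lambda>x. \<exists>w. w \<prec> f x \<and> (w \<in> c (f x) \<and> a \<prec> w))"
      using ae_conj[OF c above[OF a]] by (rule ae_mono) (auto simp: cofinal_below_def)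
    from ex_regressive[OF this] obtain b where b: "b \<in> Field r"
      "ae (\<lambda>x. \<exists>w. w \<preceq> b \<and> w \<prec> f x \<and> w \<in> c (f x) \<and> a \<prec> w)" by blast
    from b(2) have "ae (\<lambda>x. \<exists>w\<in>c (f x). a \<prec> w \<and> w \<preceq> b)" by (rule ae_mono) blast
    then show ?thesis using b(1) by blast
  qed
  then have "\<forall>a\<in>Field r. \<exists>b. b \<in> Field r \<and> ae (\<lambda>x. \<exists>w\<in>c (f x). a \<prec> w \<and> w \<preceq> b)" by blast
  from bchoice[OF this] obtain s
    where s': "\<forall>a\<in>Field r. s a \<in> Field r \<and> ae (\<lambda>x. \<exists>w\<in>c (f x). a \<prec> w \<and> w \<preceq> s a)" ..
  then have s: "\<And>a. a \<in> Field r \<Longrightarrow> s a \<in> Field r"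
    "\<And>a. a \<in> Field r \<Longrightarrow> ae (\<lambda>x. \<exists>w\<in>c (f x). a \<prec> w \<and> w \<preceq> s a)" by simp_all
  obtain S where S: "S \<subseteq> Field r" "|S| =o r" "\<And>a b. a \<in> S \<Longrightarrow> b \<in> S \<Longrightarrow> a \<prec> b \<Longrightarrow> s a \<preceq> b"
    using spaced_subset[of s] s(1) by blast
  \<comment> \<open>By the choice of \<open>s\<close>, the set \<open>c (f x)\<close> meets the
    half-open interval from \<open>a\<close> to \<open>s a\<close> almost everywhere. For
    \<open>a \<in> S\<close> these intervals are disjoint, so \<open>V e\<close> is no larger than
    \<open>c e\<close>.\<close>
  define V where "V e = {a \<in> S. \<exists>w\<in>c e. a \<prec> w \<and> w \<preceq> s a}" for e
  have V: "|V e| \<le>o |c e|" for e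
  proof -
    have "\<forall>a\<in>V e. \<exists>w. w \<in> c e \<and> a \<prec> w \<and> w \<preceq> s a" by (auto simp: V_def)
    from bchoice[OF this] obtain w where w: "\<forall>a\<in>V e. w a \<in> c e \<and> a \<prec> w a \<and> w a \<preceq> s a" ..
    have "w a \<noteq> w b" if "a \<in> V e" "b \<in> V e" "a \<prec> b" for a b
    proof -
      have "w a \<preceq> b" using S(3)[of a b] that w leq_trans by (auto simp: V_def)
      then have "w a \<prec> w b" using w that(2) leq_less_trans by blast
      then show ?thesis using less_irrefl by auto
    qed
    moreover have "V e \<subseteq> Field r" using S(1) by (auto simp: V_def)
    ultimately have "inj_on w (V e)" by (intro inj_on_if_less)
    then show ?thesis using w by (intro card_of_ordLeqI) auto
  qed
  obtain p where p: "bij_betw p (Field r) S"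
    using S(2) card_of_Field_ordIso[OF Card] card_of_ordIso ordIso_symmetric ordIso_transitive by blast
  \<comment> \<open>\<open>p\<close> moves the index set \<open>S\<close> back onto
    \<open>Field r\<close>. Where the choice \<open>c e\<close> happens not to be small,
    \<open>{}\<close> is the default.\<close>
  define W where "W e = (if |c e| <o \<mu> then {a \<in> Field r. p a \<in> V e} else {})" for e
  have "|W e| <o \<mu>" for e
  proof (cases "|c e| <o \<mu>")
    case True
    have "inj_on p (W e)" using p by (auto simp: bij_betw_def W_def inj_on_def)
    moreover have "p ` W e \<subseteq> V e" by (auto simp: W_def)
    ultimately have "|W e| \<le>o |V e|" using card_of_ordLeq by blast
    then show ?thesis using V True ordLeq_ordLess_trans by blast
  next
    case False
    obtain x where "|x :: 'a set| <o \<mu>" using ae_ex[OF ae_cofinal_below] by blast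
    then show ?thesis using False card_of_empty ordLeq_ordLess_trans by (simp add: W_def) blast
  qed
  moreover have "\<exists>e\<in>Field r. Z \<subseteq> W e" if Z: "Z \<subseteq> Field r" "|Z| <o \<mu>" for Z
  proof -
    \<comment> \<open>Completeness provides one \<open>x\<close> that serves all of \<open>Z\<close>
      at once; then \<open>Z\<close> lies in the member with index \<open>f x\<close>.\<close>
    have "ae (\<lambda>x. \<forall>z\<in>Z. \<exists>w\<in>c (f x). p z \<prec> w \<and> w \<preceq> s (p z))"
      using s(2) p Z(1) S(1) by (intro ae_ball Z(2)) (auto simp: bij_betw_def)
    moreover obtain a where "a \<in> Field r" using inf by fastforce
    ultimately have "ae (\<lambda>x. (\<forall>z\<in>Z. \<exists>w\<in>c (f x). p z \<prec> w \<and> w \<preceq> s (p z)) \<and> a \<prec> f x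
      \<and> cofinal_below (c (f x)) (f x))"
      using above c by (intro ae_conj)
    from ae_ex[OF this] obtain x where x: "\<forall>z\<in>Z. \<exists>w\<in>c (f x). p z \<prec> w \<and> w \<preceq> s (p z)" "a \<prec> f x"
      "cofinal_below (c (f x)) (f x)" by blast
    have "Z \<subseteq> W (f x)"
      using x(1,3) Z(1) p by (auto simp: W_def V_def cofinal_below_def bij_betw_def)
    then show ?thesis using less_Field(2)[OF x(2)] by blast
  qed
  ultimately show thesis by (intro that[of W]) auto
qed

end

section \<open>Reflection of types and end-homogeneous sets\<close>

context weakly_normal
begin

text \<open>For \<open>e \<in> E\<close> the type of a point over \<open>V e\<close> is a subset of
  \<open>V e \<times> I\<close>, so by \<open>Pow_small\<close> fewer than \<open>r\<close> types
  occur. One realisation beyond \<open>c\<close> is taken for each type that has one; over all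
  \<open>e \<in> E\<close> these are bounded by regularity, and the bound is \<open>g\<close>. The
  cover reduces every small \<open>Z\<close> to some \<open>V e\<close>.\<close>

lemma types_reflect:
  fixes R :: "'i \<Rightarrow> 'a \<Rightarrow> 'a \<Rightarrow> bool"
  assumes I: "|I| <o \<mu>" and c: "c \<in> Field r"
    and E: "|E| <o r" "\<And>e. e \<in> E \<Longrightarrow> |V e| <o \<mu>"
    and cover: "\<And>Z. Z \<subseteq> {z. z \<preceq> c} \<Longrightarrow> |Z| <o \<mu> \<Longrightarrow> \<exists>e\<in>E. Z \<subseteq> V e"
  shows "\<exists>g\<in>Field r. \<forall>Z e. Z \<subseteq> {z. z \<preceq> c} \<and> |Z| <o \<mu> \<and> c \<prec> e \<longrightarrow>
     (\<exists>d. c \<prec> d \<and> d \<prec> g \<and> (\<forall>z\<in>Z. \<forall>i\<in>I. R i z d \<longleftrightarrow> R i z e))"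
proof -
  define tp where "tp e d = {(z, i). z \<in> V e \<and> i \<in> I \<and> R i z d}" for e d
  define X where "X e = (\<lambda>t. SOME d. c \<prec> d \<and> tp e d = t) ` tp e ` {d. c \<prec> d}" for e
  have X: "\<exists>d'\<in>X e. c \<prec> d' \<and> tp e d' = tp e d" if "c \<prec> d" for e d
  proof -
    let ?d = "SOME d'. c \<prec> d' \<and> tp e d' = tp e d"
    have "c \<prec> ?d \<and> tp e ?d = tp e d" 
      using that someI[of "\<lambda>d'. c \<prec> d' \<and> tp e d' = tp e d" d] by simp
    moreover have "?d \<in> X e" unfolding X_def by (intro imageI) (use that in simp)
    ultimately show ?thesis by blast
  qed
  have XF: "X e \<subseteq> Field r" for e
  proof
    fix y assume "y \<in> X e"
    then obtain d where "c \<prec> d" "y = (SOME d'. c \<prec> d' \<and> tp e d' = tp e d)" by (auto simp: X_def)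
    then have "c \<prec> y" using someI[of "\<lambda>d'. c \<prec> d' \<and> tp e d' = tp e d" d] by simp
    then show "y \<in> Field r" using less_Field(2) by blast
  qed
  have "|X e| <o r" if e: "e \<in> E" for e
  proof -
    have "|V e \<times> I| <o \<mu>"
    proof -
      have "|Pair z ` I| <o \<mu>" for z :: 'a using card_of_image I by (rule ordLeq_ordLess_trans)
      then have "|\<Union>z\<in>V e. Pair z ` I| <o \<mu>"
        by (intro regularCard_UNION_bound[OF Cinf_mu reg_mu E(2)[OF e]])
      moreover have "(\<Union>z\<in>V e. Pair z ` I) = V e \<times> I" by blast
      ultimately show ?thesis by simp
    qed
    then have small: "|Pow (V e \<times> I)| <o r" by (rule Pow_small)
    have "tp e ` {d. c \<prec> d} \<subseteq> Pow (V e \<times> I)" by (auto simp: tp_def)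
    from ordLeq_ordLess_trans[OF card_of_mono1[OF this] small] show ?thesis
      unfolding X_def using card_of_image by (rule ordLeq_ordLess_trans[rotated])
  qed
  then have "|\<Union>e\<in>E. X e| <o r" by (intro regularCard_UNION_bound[OF Cinf reg E(1)])
  moreover have "(\<Union>e\<in>E. X e) \<subseteq> Field r" using XF by blast
  ultimately obtain g where g: "g \<in> Field r" "\<forall>x\<in>\<Union>e\<in>E. X e. x \<prec> g"
    using small_bounded by blast
  have "\<exists>d. c \<prec> d \<and> d \<prec> g \<and> (\<forall>z\<in>Z. \<forall>i\<in>I. R i z d \<longleftrightarrow> R i z e)"
    if Z: "Z \<subseteq> {z. z \<preceq> c} \<and> |Z| <o \<mu> \<and> c \<prec> e" for Z e
  proof -
    obtain v where v: "v \<in> E" "Z \<subseteq> V v" using cover Z by blast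
    obtain d where d: "d \<in> X v" "c \<prec> d" "tp v d = tp v e" using X Z by blast
    have "R i z d \<longleftrightarrow> R i z e" if "z \<in> Z" "i \<in> I" for z i
    proof -
      have "(z, i) \<in> tp v d \<longleftrightarrow> (z, i) \<in> tp v e" using d(3) by simp
      then show ?thesis using v(2) that by (auto simp: tp_def)
    qed
    then show ?thesis using d(1,2) v(1) g(2) by blast
  qed
  then show ?thesis using g(1) by blast
qed

context
  fixes I :: "'i set" and R :: "'i \<Rightarrow> 'a \<Rightarrow> 'a \<Rightarrow> bool"
  assumes I: "|I| <o \<mu>"
    and reflect: "\<And>c. c \<in> Field r \<Longrightarrow>
      \<exists>g\<in>Field r. \<forall>Z e. Z \<subseteq> {z. z \<preceq> c} \<and> |Z| <o \<mu> \<and> c \<prec> e \<longrightarrow>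
     (\<exists>d. c \<prec> d \<and> d \<prec> g \<and> (\<forall>z\<in>Z. \<forall>i\<in>I. R i z d \<longleftrightarrow> R i z e))"
begin

definition reflecting :: "'a \<Rightarrow> bool" where
  "reflecting e \<longleftrightarrow> (\<forall>c Z. c \<prec> e \<longrightarrow> Z \<subseteq> {z. z \<preceq> c} \<longrightarrow> |Z| <o \<mu> \<longrightarrow>
     (\<exists>d. c \<prec> d \<and> d \<prec> e \<and> (\<forall>z\<in>Z. \<forall>i\<in>I. R i z d \<longleftrightarrow> R i z e)))"

text \<open>A failure at \<open>f x\<close> is witnessed by some \<open>c\<close> below
  \<open>f x\<close> whose reflection bound \<open>g c\<close> exceeds \<open>f x\<close>. Such
  \<open>c\<close> stay below a constant \<open>b\<close>, while \<open>g\<close> is bounded by some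
  \<open>G\<close> on the segment up to \<open>b\<close>, and \<open>f\<close> exceeds
  \<open>G\<close> almost everywhere.\<close>

lemma ae_reflecting: "ae (\<lambda>x. reflecting (f x))"
proof -
  have "\<forall>c\<in>Field r. \<exists>g. g \<in> Field r \<and> (\<forall>Z e. Z \<subseteq> {z. z \<preceq> c} \<and> |Z| <o \<mu> \<and> c \<prec> e \<longrightarrow>
     (\<exists>d. c \<prec> d \<and> d \<prec> g \<and> (\<forall>z\<in>Z. \<forall>i\<in>I. R i z d \<longleftrightarrow> R i z e)))"
    using reflect by blast
  from bchoice[OF this] obtain g where g: "\<forall>c\<in>Field r. g c \<in> Field r \<and>
     (\<forall>Z e. Z \<subseteq> {z. z \<preceq> c} \<and> |Z| <o \<mu> \<and> c \<prec> e \<longrightarrow>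
     (\<exists>d. c \<prec> d \<and> d \<prec> g c \<and> (\<forall>z\<in>Z. \<forall>i\<in>I. R i z d \<longleftrightarrow> R i z e)))" ..
  show ?thesis
  proof (rule ccontr)
    assume "\<not> ?thesis"
    then have "ae (\<lambda>x. \<not> reflecting (f x))" by (simp add: ae_not)
    then have "ae (\<lambda>x. \<exists>c. c \<prec> f x \<and> \<not> g c \<preceq> f x)"
    proof (rule ae_mono)
      fix x assume "\<not> reflecting (f x)"
      then obtain c Z where c: "c \<prec> f x" and Z: "Z \<subseteq> {z. z \<preceq> c}" "|Z| <o \<mu>"
        and no: "\<not> (\<exists>d. c \<prec> d \<and> d \<prec> f x \<and> (\<forall>z\<in>Z. \<forall>i\<in>I. R i z d \<longleftrightarrow> R i z (f x)))"
        unfolding reflecting_def by blast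
      obtain d where "c \<prec> d" "d \<prec> g c" "\<forall>z\<in>Z. \<forall>i\<in>I. R i z d \<longleftrightarrow> R i z (f x)"
        using bspec[OF g less_Field(1)[OF c]] Z c by blast
      then have "\<not> g c \<preceq> f x" using no less_leq_trans by blast
      then show "\<exists>c. c \<prec> f x \<and> \<not> g c \<preceq> f x" using c by blast
    qed
    from ex_regressive[OF this] obtain b
      where b: "b \<in> Field r" "ae (\<lambda>x. \<exists>c. c \<preceq> b \<and> c \<prec> f x \<and> \<not> g c \<preceq> f x)" by blast
    obtain G where G: "G \<in> Field r" "\<forall>c. c \<preceq> b \<longrightarrow> g c \<prec> G"
      using bounded_image[OF b(1), of g] g leq_Field(1) by blast
    obtain x c where "c \<preceq> b" "\<not> g c \<preceq> f x" "G \<prec> f x"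
      using ae_ex[OF ae_conj[OF b(2) above[OF G(1)]]] by blast
    then show False using G(2) less_trans less_imp_leq by blast
  qed
qed

text \<open>
  Separating the elements of an end-homogeneous set by elements of the small set \<open>x\<close> keeps it small,
  so that a maximal such set must be cofinal.
\<close>

definition end_homogeneous :: "'a set \<Rightarrow> 'a \<Rightarrow> 'a set \<Rightarrow> bool" where
  "end_homogeneous x e H \<longleftrightarrow> (\<forall>a\<in>H. a \<prec> e) \<and>
     (\<forall>a\<in>H. \<forall>b\<in>H. a \<prec> b \<longrightarrow> (\<forall>i\<in>I. R i a b \<longleftrightarrow> R i a e) \<and> (\<exists>w\<in>x. a \<prec> w \<and> w \<preceq> b))"

lemma end_homogeneous_small:
  assumes x: "cofinal_below x e" and H: "end_homogeneous x e H"
  shows "|H| <o \<mu>"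
proof -
  \<comment> \<open>\<open>w a\<close> is the least element of \<open>x\<close> above
    \<open>a\<close>. As \<open>x\<close> separates the elements of \<open>H\<close>, this map is
    injective on \<open>H\<close>.\<close>
  define w where "w a = (SOME v. v \<in> {v \<in> x. a \<prec> v} \<and> (\<forall>b\<in>{v \<in> x. a \<prec> v}. \<not> b \<prec> v))" for a
  have w: "w a \<in> x \<and> a \<prec> w a \<and> (\<forall>b\<in>x. a \<prec> b \<longrightarrow> \<not> b \<prec> w a)" if a: "a \<in> H" for a
  proof -
    have "a \<prec> e" using a H by (auto simp: end_homogeneous_def)
    then obtain v where "v \<in> {v \<in> x. a \<prec> v}" using x by (auto simp: cofinal_below_def)
    from least_element[OF this]
    have "\<exists>v. v \<in> {v \<in> x. a \<prec> v} \<and> (\<forall>b\<in>{v \<in> x. a \<prec> v}. \<not> b \<prec> v)" by metis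
    then have "w a \<in> {v \<in> x. a \<prec> v} \<and> (\<forall>b\<in>{v \<in> x. a \<prec> v}. \<not> b \<prec> w a)"
      unfolding w_def by (rule someI_ex)
    then show ?thesis by simp
  qed
  have "inj_on w H"
  proof (rule inj_on_if_less)
    show "H \<subseteq> Field r" using H less_Field(1) unfolding end_homogeneous_def by blast
    fix a b assume ab: "a \<in> H" "b \<in> H" "a \<prec> b"
    then obtain v where v: "v \<in> x" "a \<prec> v" "v \<preceq> b" using H unfolding end_homogeneous_def by blast
    have "v \<prec> w b" using v(3) w[OF ab(2)] leq_less_trans by blast
    then show "w a \<noteq> w b" using w[OF ab(1)] v by auto
  qed
  moreover have "w ` H \<subseteq> x" using w by blast
  ultimately have "|H| \<le>o |x|" using card_of_ordLeq by blast
  then show ?thesis using x ordLeq_ordLess_trans unfolding cofinal_below_def by blast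
qed

lemma end_homogeneous_cofinal:
  assumes x: "cofinal_below x e" and e: "reflecting e"
  shows "\<exists>H. end_homogeneous x e H \<and> (\<forall>a. a \<prec> e \<longrightarrow> (\<exists>h\<in>H. a \<prec> h))"
proof -
  let ?P = "\<lambda>a b. a \<prec> b \<longrightarrow> (\<forall>i\<in>I. R i a b \<longleftrightarrow> R i a e) \<and> (\<exists>w\<in>x. a \<prec> w \<and> w \<preceq> b)"
  obtain H where H: "H \<subseteq> {a. a \<prec> e}" "\<forall>a\<in>H. \<forall>b\<in>H. a \<noteq> b \<longrightarrow> ?P a b"
    "\<forall>c\<in>{a. a \<prec> e}. (\<forall>a\<in>H. a \<noteq> c \<longrightarrow> ?P a c \<and> ?P c a) \<longrightarrow> c \<in> H"
    using maximal_clique[of "{a. a \<prec> e}" ?P] .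
  have eh: "end_homogeneous x e H"
    unfolding end_homogeneous_def
  proof (intro conjI ballI)
    show "a \<prec> e" if "a \<in> H" for a using H(1) that by blast
    show "?P a b" if "a \<in> H" "b \<in> H" for a b
      using H(2) that less_irrefl[of a] by (cases "a = b") simp_all
  qed
  have "\<exists>h\<in>H. a \<prec> h" if a: "a \<prec> e" for a
  proof (rule ccontr)
    assume no: "\<not> (\<exists>h\<in>H. a \<prec> h)"
    have le: "h \<preceq> a" if "h \<in> H" for h
    proof -
      have "h \<in> Field r" using H(1) that less_Field(1) by blast
      then show ?thesis using no that not_less less_Field(1)[OF a] by blast
    qed
    \<comment> \<open>If \<open>a\<close> bounds \<open>H\<close>, a point \<open>d\<close> beyond
      \<open>w\<close> with the type of \<open>e\<close> over \<open>H\<close> can be added: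
      \<open>w\<close> separates it from all of \<open>H\<close>, and the equality of types gives
      homogeneity.\<close>
    obtain w where w: "w \<in> x" "a \<prec> w" "w \<prec> e" using x a by (auto simp: cofinal_below_def)
    have "H \<subseteq> {z. z \<preceq> w}" using le w(2) less_imp_leq leq_trans by blast
    moreover have "|H| <o \<mu>" using end_homogeneous_small[OF x eh] .
    ultimately obtain d where d: "w \<prec> d" "d \<prec> e" "\<forall>z\<in>H. \<forall>i\<in>I. R i z d \<longleftrightarrow> R i z e"
      using e w(3) unfolding reflecting_def by blast
    have "?P h d \<and> ?P d h" if h: "h \<in> H" for h
    proof
      have "h \<prec> w" using le[OF h] w(2) by (rule leq_less_trans)
      then show "?P h d" using d(1,3) h w(1) less_imp_leq by blast
      have "\<not> d \<prec> h" using less_trans[OF \<open>h \<prec> w\<close> d(1)] less_trans less_irrefl by blast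
      then show "?P d h" by blast
    qed
    then have "d \<in> H" using H(3) d(2) by simp
    then show False using no less_trans[OF w(2) d(1)] by blast
  qed
  then show ?thesis using eh by blast
qed

text \<open>
  In the ultrapower, cofinally many elements of one end-homogeneous set interleave with constants, and
  the constants inherit homogeneity.
\<close>

lemma homogeneous_chain:
  assumes D: "filter_on I D"
    and edge: "\<And>a b. a \<prec> b \<Longrightarrow> {i \<in> I. R i a b} \<in> D"
    and trans: "\<And>i a b c. i \<in> I \<Longrightarrow> R i a b \<Longrightarrow> R i b c \<Longrightarrow> R i a c"
  shows "\<exists>i\<in>I. \<exists>N \<subseteq> Field r. |N| =o r \<and> (\<forall>a\<in>N. \<forall>b\<in>N. a \<prec> b \<longrightarrow> R i a b)"
proof -
  define H where "H x = (SOME H. end_homogeneous x (f x) H \<and> (\<forall>a. a \<prec> f x \<longrightarrow> (\<exists>h\<in>H. a \<prec> h)))" for x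
  have H: "ae (\<lambda>x. end_homogeneous x (f x) (H x) \<and> (\<forall>a. a \<prec> f x \<longrightarrow> (\<exists>h\<in>H x. a \<prec> h)))"
    using ae_conj[OF ae_cofinal_below ae_reflecting]
    by (rule ae_mono) (unfold H_def, rule someI_ex, use end_homogeneous_cofinal in blast)
  have Heh: "ae (\<lambda>x. end_homogeneous x (f x) (H x))" using H by (rule ae_mono) simp
  have "\<exists>b\<in>Field r. ae (\<lambda>x. \<exists>h\<in>H x. a \<prec> h \<and> h \<prec> b)" if a: "a \<in> Field r" for a
  proof -
    have "ae (\<lambda>x. \<exists>h. h \<prec> f x \<and> (h \<in> H x \<and> a \<prec> h))"
      using ae_conj[OF H above[OF a]]
    proof (rule ae_mono)
      fix x assume x: "(end_homogeneous x (f x) (H x) \<and> (\<forall>a. a \<prec> f x \<longrightarrow> (\<exists>h\<in>H x. a \<prec> h))) \<and> a \<prec> f x"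
      then obtain h where "h \<in> H x" "a \<prec> h" by blast
      then show "\<exists>h. h \<prec> f x \<and> (h \<in> H x \<and> a \<prec> h)" using x unfolding end_homogeneous_def by blast
    qed
    from ex_regressive[OF this] obtain b where b: "b \<in> Field r"
      "ae (\<lambda>x. \<exists>h. h \<preceq> b \<and> h \<prec> f x \<and> h \<in> H x \<and> a \<prec> h)" by blast
    obtain c where c: "b \<prec> c" using greater_exists[OF b(1)] by blast
    from b(2) have "ae (\<lambda>x. \<exists>h\<in>H x. a \<prec> h \<and> h \<prec> c)"
      by (rule ae_mono) (use c leq_less_trans in blast)
    then show ?thesis using less_Field(2)[OF c] by blast
  qed
  then have "\<forall>a\<in>Field r. \<exists>b. b \<in> Field r \<and> ae (\<lambda>x. \<exists>h\<in>H x. a \<prec> h \<and> h \<prec> b)" by blast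
  from bchoice[OF this] obtain s
    where s': "\<forall>a\<in>Field r. s a \<in> Field r \<and> ae (\<lambda>x. \<exists>h\<in>H x. a \<prec> h \<and> h \<prec> s a)" ..
  then have s: "\<And>a. a \<in> Field r \<Longrightarrow> s a \<in> Field r"
    "\<And>a. a \<in> Field r \<Longrightarrow> ae (\<lambda>x. \<exists>h\<in>H x. a \<prec> h \<and> h \<prec> s a)" by simp_all
  \<comment> \<open>The constant \<open>s a\<close> is caught between two elements of
    \<open>H x\<close>, with edges in coordinate \<open>i\<close>. By end-homogeneity, the edge from
    \<open>h'\<close> to \<open>f x\<close> will give an edge from \<open>h'\<close> to any later
    element of \<open>H x\<close>.\<close>
  let ?T = "\<lambda>a i x. \<exists>h\<in>H x. \<exists>h'\<in>H x. a \<prec> h \<and> h \<prec> s a \<and> s a \<prec> h' \<and> h' \<prec> s (s a) \<and>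
      R i h (s a) \<and> R i (s a) h' \<and> R i h (f x) \<and> R i h' (f x)"
  \<comment> \<open>For one \<open>x\<close>, the finitely many required edges hold together on a
    set in \<open>D\<close>, so some \<open>i\<close> serves. As there are fewer than \<mu>
    coordinates, a single \<open>i\<close> serves almost every \<open>x\<close>.\<close>
  have "\<exists>i\<in>I. ae (?T a i)" if a: "a \<in> Field r" for a
  proof (rule ae_bex[OF I])
    show "ae (\<lambda>x. \<exists>i\<in>I. ?T a i x)"
      using ae_conj[OF Heh ae_conj[OF s(2)[OF a] s(2)[OF s(1)[OF a]]]]
    proof (rule ae_mono)
      fix x assume x: "end_homogeneous x (f x) (H x) \<and> (\<exists>h\<in>H x. a \<prec> h \<and> h \<prec> s a) \<and>
        (\<exists>h\<in>H x. s a \<prec> h \<and> h \<prec> s (s a))"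
      then obtain h h' where h: "h \<in> H x" "a \<prec> h" "h \<prec> s a" "h' \<in> H x" "s a \<prec> h'" "h' \<prec> s (s a)"
        by blast
      then have "h \<prec> f x" "h' \<prec> f x" using x unfolding end_homogeneous_def by blast+
      then have "{i \<in> I. (R i h (s a) \<and> R i (s a) h') \<and> R i h (f x) \<and> R i h' (f x)} \<in> D"
        using h by (intro filter_on_conj[OF D] edge)
      then have "{i \<in> I. (R i h (s a) \<and> R i (s a) h') \<and> R i h (f x) \<and> R i h' (f x)} \<noteq> {}"
        using D unfolding filter_on_def by metis
      then obtain i where "i \<in> I" "R i h (s a)" "R i (s a) h'" "R i h (f x)" "R i h' (f x)" by blast
      then show "\<exists>i\<in>I. ?T a i x" using h by blast
    qed
  qed
  then have "\<forall>a\<in>Field r. \<exists>i. i \<in> I \<and> ae (?T a i)" by blast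
  from bchoice[OF this] obtain j where j: "\<forall>a\<in>Field r. j a \<in> I \<and> ae (?T a (j a))" ..
  \<comment> \<open>Spacing by two applications of \<open>s\<close> puts the element of
    \<open>H x\<close> that follows \<open>s a\<close> before every later \<open>b \<in> S\<close>,
    hence before the element of \<open>H x\<close> caught between \<open>b\<close> and
    \<open>s b\<close>.\<close>
  obtain S where S: "S \<subseteq> Field r" "|S| =o r" "\<And>a b. a \<in> S \<Longrightarrow> b \<in> S \<Longrightarrow> a \<prec> b \<Longrightarrow> s (s a) \<preceq> b"
    using spaced_subset[of "\<lambda>a. s (s a)"] s(1) by blast
  \<comment> \<open>Pigeonhole: \<open>r\<close> is regular and larger than \<open>I\<close>, so one
    coordinate serves for \<open>r\<close> many \<open>a\<close>.\<close>
  have "\<exists>i\<in>I. \<not> |{a \<in> S. j a = i}| <o r"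
  proof (rule ccontr)
    assume "\<not> ?thesis"
    then have "|\<Union>i\<in>I. {a \<in> S. j a = i}| <o r"
      using ordLess_ordLeq_trans[OF I mu_leq] by (intro regularCard_UNION_bound[OF Cinf reg]) auto
    moreover have "(\<Union>i\<in>I. {a \<in> S. j a = i}) = S" using j S(1) by blast
    ultimately show False using S(2) not_ordLess_ordIso by auto
  qed
  then obtain i where i: "i \<in> I" "\<not> |{a \<in> S. j a = i}| <o r" by blast
  let ?S = "{a \<in> S. j a = i}"
  have asc: "a \<prec> s a" if "a \<in> Field r" for a
    using ae_ex[OF s(2)[OF that]] less_trans by blast
  have mono: "s a \<prec> s b" if "a \<in> S" "b \<in> S" "a \<prec> b" for a b
  proof -
    have ab: "a \<in> Field r" "b \<in> Field r" using that S(1) by auto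
    have "s a \<prec> b" using asc[OF s(1)[OF ab(1)]] S(3)[OF that] by (rule less_leq_trans)
    then show ?thesis using asc[OF ab(2)] by (rule less_trans)
  qed
  have R: "R i (s a) (s b)" if ab: "a \<in> ?S" "b \<in> ?S" "a \<prec> b" for a b
  proof -
    have F: "a \<in> Field r" "b \<in> Field r" and ji: "j a = i" "j b = i" using ab S(1) by auto
    have T: "ae (?T a i)" "ae (?T b i)"
      using conjunct2[OF bspec[OF j F(1)]] conjunct2[OF bspec[OF j F(2)]] unfolding ji .
    \<comment> \<open>A common \<open>x\<close> for \<open>a\<close> and \<open>b\<close> gives a
      path of edges from \<open>s a\<close> to \<open>h\<close>, inside \<open>H x\<close> from
      \<open>h\<close> to \<open>k\<close>, and from \<open>k\<close> to \<open>s b\<close>;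
      transitivity composes them.\<close>
    from ae_ex[OF ae_conj[OF Heh ae_conj[OF T]]] obtain x where x: "end_homogeneous x (f x) (H x)"
      and T: "?T a i x" "?T b i x" by blast
    from T(1) obtain h where h: "h \<in> H x" "h \<prec> s (s a)" "R i (s a) h" "R i h (f x)" by blast
    from T(2) obtain k where k: "k \<in> H x" "b \<prec> k" "R i k (s b)" by blast
    have "s (s a) \<preceq> b" using S(3) ab by simp
    then have "h \<prec> k" using h(2) k(2) less_leq_trans less_trans by blast
    then have "R i h k" using x h(1,4) k(1) i(1) unfolding end_homogeneous_def by blast
    then show ?thesis using trans[OF i(1)] h(3) k(3) by blast
  qed
  have "inj_on s ?S"
  proof (rule inj_on_if_less)
    show "s a \<noteq> s b" if "a \<in> ?S" "b \<in> ?S" "a \<prec> b" for a b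
      using mono[of a b] that less_irrefl[of "s b"] by auto
  qed (use S(1) in auto)
  then have "|s ` ?S| =o |?S|" using card_of_ordIsoI inj_on_imp_bij_betw ordIso_symmetric by blast
  moreover have "|?S| =o r"
  proof -
    have "|?S| \<le>o |S|" by (rule card_of_mono1) auto
    then have "|?S| \<le>o r" using S(2) by (rule ordLeq_ordIso_trans)
    then show ?thesis using i(2) ordLeq_iff_ordLess_or_ordIso by blast
  qed
  ultimately have "|s ` ?S| =o r" by (rule ordIso_transitive)
  moreover have "s ` ?S \<subseteq> Field r" using S(1) s(1) by blast
  moreover have "R i x y" if xy: "x \<in> s ` ?S" "y \<in> s ` ?S" "x \<prec> y" for x y
  proof -
    obtain a b where ab: "a \<in> ?S" "b \<in> ?S" "x = s a" "y = s b" using xy(1,2) by blast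
    have "a \<prec> b"
    proof (rule ccontr)
      assume "\<not> a \<prec> b"
      then have "b \<preceq> a" using not_less ab(1,2) S(1) by blast
      then have "b = a \<or> b \<prec> a" by (rule leq_cases)
      then show False using mono[of b a] ab xy(3) less_irrefl less_trans by blast
    qed
    then show ?thesis using R ab by blast
  qed
  ultimately have "s ` ?S \<subseteq> Field r \<and> |s ` ?S| =o r \<and>
      (\<forall>a\<in>s ` ?S. \<forall>b\<in>s ` ?S. a \<prec> b \<longrightarrow> R i a b)"
    by (intro conjI ballI impI)
  then show ?thesis by (intro bexI[OF _ i(1)] exI[of _ "s ` ?S"])
qed

end
end

section \<open>Depth of ultraproducts\<close>

lemma Card_order_not_ordLeq: "Card_order r \<Longrightarrow> Card_order s \<Longrightarrow> \<not> r \<le>o s \<Longrightarrow> s <o r"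
  using not_ordLeq_iff_ordLess by (auto simp: card_order_on_def)

text \<open>A small set is coded as the singleton of its image under \<open>a\<close>; the singleton
  lifts the code to the type \<open>'c set set\<close>. With \<open>'c\<close> the type of elements
  of the ultraproduct, this is where compactness is assumed below.\<close>

lemma extends_small_subsets:
  fixes a :: "'a \<Rightarrow> 'c"
  assumes sc: "strongly_compact TYPE('c set set) \<mu>" and a: "inj_on a A"
  shows "extends_complete_filters \<mu> (small_subsets \<mu> A)"
proof (rule strongly_compact_imp_extends[OF sc])
  show "inj_on (\<lambda>x. {a ` x}) (small_subsets \<mu> A)"
  proof (rule inj_onI)
    fix x y assume "x \<in> small_subsets \<mu> A" "y \<in> small_subsets \<mu> A" "{a ` x} = {a ` y}"
    then have "x \<subseteq> A" "y \<subseteq> A" "a ` x = a ` y" by auto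
    then show "x = y" using inj_on_image_eq_iff[OF a] by blast
  qed
qed

text \<open>A strictly increasing map from a linear order to a partial order is an order embedding,
  so well-foundedness passes to the image along the inverse of \<open>h\<close>.\<close>

lemma (in regular_cardinal) well_ordered_in_image:
  assumes L: "partial_order L" and N: "N \<subseteq> Field r" "h ` N \<subseteq> carrier L"
    and mono: "\<And>a b. a \<in> N \<Longrightarrow> b \<in> N \<Longrightarrow> a \<prec> b \<Longrightarrow> h a \<sqsubseteq>\<^bsub>L\<^esub> h b \<and> h a \<noteq> h b"
  shows "well_ordered_in L (h ` N)" "inj_on h N"
proof -
  interpret partial_order L by (rule L)
  show inj: "inj_on h N" using mono by (intro inj_on_if_less N(1)) blast
  let ?A = "h ` N" and ?r = "{(x, y). x \<in> h ` N \<and> y \<in> h ` N \<and> x \<sqsubseteq>\<^bsub>L\<^esub> y}"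
  have le: "h a \<sqsubseteq>\<^bsub>L\<^esub> h b \<longleftrightarrow> a \<preceq> b" if "a \<in> N" "b \<in> N" for a b
  proof
    have F: "a \<in> Field r" "b \<in> Field r" "h a \<in> carrier L" "h b \<in> carrier L" using that N by auto
    show "a \<preceq> b" if "h a \<sqsubseteq>\<^bsub>L\<^esub> h b"
    proof (rule ccontr)
      assume "\<not> a \<preceq> b"
      then have "b \<prec> a" using not_less[OF F(2,1)] by blast
      then have "h b \<sqsubseteq>\<^bsub>L\<^esub> h a" "h b \<noteq> h a" using mono \<open>a \<in> N\<close> \<open>b \<in> N\<close> by blast+
      then show False using le_antisym[OF that _ F(3,4)] by simp
    qed
    show "h a \<sqsubseteq>\<^bsub>L\<^esub> h b" if "a \<preceq> b"
      using leq_cases[OF that] mono[OF \<open>a \<in> N\<close> \<open>b \<in> N\<close>] le_refl[OF F(3)] by blast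
  qed
  have "wf (inv_image (r - Id) (inv_into N h))" by (rule wf_inv_image[OF lin(5)])
  moreover have "?r - Id \<subseteq> inv_image (r - Id) (inv_into N h)"
    using le inj by (auto simp: leq_def)
  ultimately have "wf (?r - Id)" by (rule wf_subset)
  moreover have "refl_on ?A ?r" "?r \<subseteq> ?A \<times> ?A"
    using N(2) le_refl by (auto simp: refl_on_def)
  moreover have "trans ?r"
    using le leq_trans by (auto simp: trans_def)
  moreover have "antisym ?r"
    by (rule antisymI) (use le_antisym N(2) in blast)
  moreover have "total_on ?A ?r"
    unfolding total_on_def
  proof (intro ballI impI)
    fix x y assume "x \<in> ?A" "y \<in> ?A"
    then obtain a b where ab: "a \<in> N" "b \<in> N" "x = h a" "y = h b" by blast
    then have "a \<preceq> b \<or> b \<preceq> a"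
      using not_less[of a b] less_imp_leq[of a b] N(1) by (auto dest: subsetD)
    then show "(x, y) \<in> ?r \<or> (y, x) \<in> ?r" using le ab by auto
  qed
  ultimately have "well_order_on ?A ?r"
    by (simp add: well_order_on_def linear_order_on_def partial_order_on_def preorder_on_def)
  then show "well_ordered_in L ?A" using N(2) by (simp add: well_ordered_in_def)
qed

text \<open>The singleton of the top element is well ordered. Nonemptiness supplies default
  coordinates in the ultraproduct of the depths.\<close>

lemma Field_Depth_nonempty:
  assumes "boolean_lattice L"
  shows "Field (Depth L) \<noteq> {}"
proof -
  interpret boolean_lattice L by (rule assms)
  have "{(x, y). x \<in> {\<top>\<^bsub>L\<^esub>} \<and> y \<in> {\<top>\<^bsub>L\<^esub>} \<and> x \<sqsubseteq>\<^bsub>L\<^esub> y} = {(\<top>\<^bsub>L\<^esub>, \<top>\<^bsub>L\<^esub>)}"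
    by auto
  moreover have "{(\<top>\<^bsub>L\<^esub>, \<top>\<^bsub>L\<^esub>)} - Id = {}" by auto
  ultimately have "well_ordered_in L {\<top>\<^bsub>L\<^esub>}"
    by (simp add: well_ordered_in_def well_order_on_def linear_order_on_def partial_order_on_def
        preorder_on_def refl_on_def trans_def antisym_def total_on_def)
  then have "|{\<top>\<^bsub>L\<^esub>}| \<le>o |Field (Depth L)|"
    using Depth_upper card_of_Field_ordIso[OF Card_order_Depth] ordIso_symmetric ordLeq_ordIso_trans
    by blast
  then show ?thesis using card_of_ordLeq by (metis empty_not_insert image_is_empty subset_empty)
qed

text \<open>Injections into the large factors are combined coordinatewise, with arbitrary values
  elsewhere. If two images agree modulo \<open>D\<close>, they agree at some large coordinate, where
  injectivity identifies the arguments.\<close>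

lemma card_ultraproduct_ge:
  assumes D: "filter_on I D" and X: "\<And>i. i \<in> I \<Longrightarrow> X i \<noteq> {}"
    and large: "{i \<in> I. |S| \<le>o |X i| } \<in> D"
  shows "|S| \<le>o |ultraproduct_set I D X|"
proof -
  let ?G = "{i \<in> I. |S| \<le>o |X i| }"
  have "\<forall>i\<in>?G. \<exists>g. inj_on g S \<and> g ` S \<subseteq> X i" by (simp add: card_of_ordLeq)
  from bchoice[OF this] obtain g where g: "\<forall>i\<in>?G. inj_on (g i) S \<and> g i ` S \<subseteq> X i" ..
  define h where "h c = (\<lambda>i\<in>I. if i \<in> ?G then g i c else SOME y. y \<in> X i)" for c
  have h: "h c \<in> Pi\<^sub>E I X" if c: "c \<in> S" for c
  proof (rule PiE_I)
    fix i assume i: "i \<in> I"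
    show "h c i \<in> X i"
    proof (cases "i \<in> ?G")
      case True
      then show ?thesis using bspec[OF g True] c i by (auto simp: h_def)
    next
      case False
      then show ?thesis using X[OF i] i by (auto simp: h_def some_in_eq)
    qed
  qed (simp add: h_def)
  have "inj_on (\<lambda>c. ultra_rel I D X `` {h c}) S"
  proof (rule inj_onI)
    fix c d assume cd: "c \<in> S" "d \<in> S" "ultra_rel I D X `` {h c} = ultra_rel I D X `` {h d}"
    then have "(h c, h d) \<in> ultra_rel I D X"
      using eq_equiv_class_iff[OF equiv_ultra_rel[OF D] h h] by blast
    then have "{i \<in> I. h c i = h d i} \<in> D" by (simp add: ultra_rel_def)
    then have "{i \<in> I. h c i = h d i \<and> |S| \<le>o |X i| } \<in> D"
      using large by (rule filter_on_conj[OF D])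
    then have "{i \<in> I. h c i = h d i \<and> |S| \<le>o |X i| } \<noteq> {}" using D unfolding filter_on_def by metis
    then obtain i where i: "i \<in> ?G" "h c i = h d i" by blast
    then have "g i c = g i d" by (simp add: h_def)
    then show "c = d" using bspec[OF g i(1)] cd(1,2) by (meson inj_onD)
  qed
  then show ?thesis
    by (rule card_of_ordLeqI) (use h in \<open>auto simp: ultraproduct_set_def intro: quotientI\<close>)
qed

text \<open>The bound on the factors is asked only modulo \<open>D\<close>, which is the form that a
  bound on the ultraproduct of the depths provides.\<close>

lemma Depth_ultraproduct_le:
  fixes B :: "'i \<Rightarrow> 'b gorder" and \<chi> :: "'l rel" and \<mu> :: "'m rel"
  assumes D: "ultrafilter_on I D" and BL: "\<And>i. i \<in> I \<Longrightarrow> boolean_lattice (B i)"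
    and sc: "strongly_compact TYPE(('i \<Rightarrow> 'b) set set set) \<mu>"
    and I: "|I| <o \<mu>" and chi: "Cinfinite \<chi>" "\<mu> \<le>o \<chi>"
    and large: "{i \<in> I. Depth (B i) \<le>o \<chi>} \<in> D"
  shows "Depth (ultraproduct I D B) \<le>o cardSuc \<chi>"
proof (rule Depth_least)
  show "Card_order (cardSuc \<chi>)" using chi(1) by (simp add: cardSuc_Card_order)
  fix A assume A: "well_ordered_in (ultraproduct I D B) A"
  let ?\<nu> = "cardSuc \<chi>"
  \<comment> \<open>A chain larger than \<open>?\<nu>\<close> has length at least
    \<open>?\<kappa>\<close>, whose proper initial segments have size at most \<open>?\<nu>\<close>.
    Hence a cover of the small sets at \<open>?\<nu>\<close> gives reflection at
    \<open>?\<kappa>\<close>.\<close>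
  let ?\<kappa> = "cardSuc ?\<nu>"
  have F: "filter_on I D" using D by (simp add: ultrafilter_on_def)
  have mu: "Cinfinite \<mu>" "regularCard \<mu>" "natLeq <o \<mu>"
  proof -
    show nat: "natLeq <o \<mu>" and "regularCard \<mu>" using sc by (auto simp: strongly_compact_def)
    have "Card_order \<mu>" using sc by (simp add: strongly_compact_def)
    moreover have "cinfinite \<mu>"
      using cinfinite_mono[OF ordLess_imp_ordLeq[OF nat]] natLeq_cinfinite by blast
    ultimately show "Cinfinite \<mu>" by simp
  qed
  have nu: "Cinfinite ?\<nu>" "regularCard ?\<nu>" and kappa: "Cinfinite ?\<kappa>" "regularCard ?\<kappa>"
    by (intro Cinfinite_cardSuc regularCard_cardSuc chi(1))+
  have chi_nu: "\<chi> <o ?\<nu>" and nu_kappa: "?\<nu> <o ?\<kappa>"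
    by (rule cardSuc_greater[OF conjunct2[OF chi(1)]], rule cardSuc_greater[OF conjunct2[OF nu(1)]])
  have mu_nu: "\<mu> \<le>o ?\<nu>" using chi(2) ordLess_imp_ordLeq[OF chi_nu] by (rule ordLeq_transitive)
  have mu_kappa: "\<mu> \<le>o ?\<kappa>" using mu_nu ordLess_imp_ordLeq[OF nu_kappa] by (rule ordLeq_transitive)
  show "|A| \<le>o ?\<nu>"
  proof (rule ccontr)
    assume "\<not> |A| \<le>o ?\<nu>"
    then have "?\<nu> <o |A|" using Card_order_not_ordLeq[OF card_of_Card_order conjunct2[OF nu(1)]] by blast
    then have "?\<kappa> \<le>o |A|" by (rule cardSuc_least[OF conjunct2[OF nu(1)] card_of_Card_order])
    moreover have wo: "well_order_on A {(x, y). x \<in> A \<and> y \<in> A \<and> x \<sqsubseteq>\<^bsub>ultraproduct I D B\<^esub> y}"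
      using A by (simp add: well_ordered_in_def)
    ultimately have "?\<kappa> \<le>o {(x, y). x \<in> A \<and> y \<in> A \<and> x \<sqsubseteq>\<^bsub>ultraproduct I D B\<^esub> y}"
      using card_of_least[OF wo] ordLeq_transitive by blast
    then obtain a where a: "embed ?\<kappa> {(x, y). x \<in> A \<and> y \<in> A \<and> x \<sqsubseteq>\<^bsub>ultraproduct I D B\<^esub> y} a"
      by (auto simp: ordLeq_def)
    have kWell: "Well_order ?\<kappa>" using kappa(1) by (simp add: card_order_on_def)
    have inj: "inj_on a (Field ?\<kappa>)" using embed_inj_on[OF kWell a] .
    have le: "a x \<sqsubseteq>\<^bsub>ultraproduct I D B\<^esub> a y" "a x \<in> A" "a y \<in> A" if "(x, y) \<in> ?\<kappa>" for x y
      using embed_compat[OF a] that by (auto simp: compat_def)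
    have "|Field ?\<nu>| \<le>o |Field ?\<kappa>|" using nu_kappa by (intro card_of_mono2 ordLess_imp_ordLeq)
    then obtain t where t: "inj_on t (Field ?\<nu>)" "t ` Field ?\<nu> \<subseteq> Field ?\<kappa>"
      unfolding card_of_ordLeq[symmetric] by blast
    \<comment> \<open>Both index sets are coded through the chain itself: \<open>a\<close> maps the
      field of \<open>?\<kappa>\<close> into the ultraproduct, and \<open>t\<close> injects the
      field of \<open>?\<nu>\<close> into that of \<open>?\<kappa>\<close>.\<close>
    have "inj_on (a \<circ> t) (Field ?\<nu>)" using t inj by (meson comp_inj_on inj_on_subset)
    from weakly_normal_exists[OF nu mu mu_nu extends_small_subsets[OF sc this]]
    obtain Vn fn where "weakly_normal ?\<nu> \<mu> Vn fn" by blast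
    then interpret N: weakly_normal ?\<nu> \<mu> Vn fn .
    from weakly_normal_exists[OF kappa mu mu_kappa extends_small_subsets[OF sc inj]]
    obtain Vk fk where "weakly_normal ?\<kappa> \<mu> Vk fk" by blast
    then interpret K: weakly_normal ?\<kappa> \<mu> Vk fk .
    obtain W where W: "\<forall>e\<in>Field ?\<nu>. |W e| <o \<mu>"
      "\<forall>Z. Z \<subseteq> Field ?\<nu> \<and> |Z| <o \<mu> \<longrightarrow> (\<exists>e\<in>Field ?\<nu>. Z \<subseteq> W e)"
      using N.small_cover .
    have "\<forall>x\<in>Field ?\<kappa>. \<exists>h. h \<in> (\<Pi>\<^sub>E i\<in>I. carrier (B i)) \<and>
        a x = ultra_rel I D (\<lambda>i. carrier (B i)) `` {h}"
    proof
      fix x assume "x \<in> Field ?\<kappa>"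
      then have "a x \<in> A" using le(2)[of x x] K.leq_refl by (simp add: K.leq_def)
      then have "a x \<in> carrier (ultraproduct I D B)" using A by (auto simp: well_ordered_in_def)
      then show "\<exists>h. h \<in> (\<Pi>\<^sub>E i\<in>I. carrier (B i)) \<and> a x = ultra_rel I D (\<lambda>i. carrier (B i)) `` {h}"
        by (auto simp: ultraproduct_def ultraproduct_set_def quotient_def)
    qed
    from bchoice[OF this] obtain h where h: "\<forall>x\<in>Field ?\<kappa>. h x \<in> (\<Pi>\<^sub>E i\<in>I. carrier (B i)) \<and>
        a x = ultra_rel I D (\<lambda>i. carrier (B i)) `` {h x}" ..
    \<comment> \<open>The strict order of the representatives at coordinate \<open>i\<close>. The
      clause on \<open>Depth (B i)\<close> lets a single edge certify that this coordinate obeys the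
      depth bound.\<close>
    define R where "R i x y \<longleftrightarrow> Depth (B i) \<le>o \<chi> \<and> x \<in> Field ?\<kappa> \<and> y \<in> Field ?\<kappa> \<and>
        h x i \<sqsubseteq>\<^bsub>B i\<^esub> h y i \<and> h x i \<noteq> h y i" for i x y
    have edge: "{i \<in> I. R i x y} \<in> D" if xy: "K.less x y" for x y
    proof -
      have xF: "x \<in> Field ?\<kappa>" "y \<in> Field ?\<kappa>" using K.less_Field xy by blast+
      have hx: "h x \<in> (\<Pi>\<^sub>E i\<in>I. carrier (B i))" "a x = ultra_rel I D (\<lambda>i. carrier (B i)) `` {h x}"
        and hy: "h y \<in> (\<Pi>\<^sub>E i\<in>I. carrier (B i))" "a y = ultra_rel I D (\<lambda>i. carrier (B i)) `` {h y}"
        using h xF by blast+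
      have "a x \<sqsubseteq>\<^bsub>ultraproduct I D B\<^esub> a y" using le(1) xy by (simp add: K.less_def)
      then obtain p q where pq: "{i \<in> I. h x i = p i} \<in> D" "{i \<in> I. h y i = q i} \<in> D"
        "{i \<in> I. p i \<sqsubseteq>\<^bsub>B i\<^esub> q i} \<in> D"
        unfolding hx(2) hy(2) by (auto simp: ultraproduct_def ultra_rel_def)
      have "a x \<noteq> a y" using inj xF xy by (auto simp: K.less_def inj_on_def)
      then have "(h x, h y) \<notin> ultra_rel I D (\<lambda>i. carrier (B i))"
        unfolding hx(2) hy(2) using equiv_class_eq[OF equiv_ultra_rel[OF F]] by blast
      then have "{i \<in> I. h x i = h y i} \<notin> D" using hx(1) hy(1) by (simp add: ultra_rel_def)
      moreover have "{i \<in> I. h x i = h y i} \<in> D \<or> I - {i \<in> I. h x i = h y i} \<in> D"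
        using D Collect_subset[of I "\<lambda>i. h x i = h y i"] unfolding ultrafilter_on_def by blast
      moreover have "I - {i \<in> I. h x i = h y i} = {i \<in> I. h x i \<noteq> h y i}" by blast
      ultimately have ne: "{i \<in> I. h x i \<noteq> h y i} \<in> D" by simp
      have "{i \<in> I. h x i = p i \<and> h y i = q i \<and> p i \<sqsubseteq>\<^bsub>B i\<^esub> q i \<and> h x i \<noteq> h y i \<and> Depth (B i) \<le>o \<chi>} \<in> D"
        using pq ne large by (intro filter_on_conj[OF F])
      then show ?thesis by (rule filter_on_mono[OF F]) (auto simp: R_def xF)
    qed
    have trans: "R i x z" if i: "i \<in> I" and xyz: "R i x y" "R i y z" for i x y z
    proof -
      interpret boolean_lattice "B i" using BL[OF i] .
      have C: "h x i \<in> carrier (B i)" "h y i \<in> carrier (B i)" "h z i \<in> carrier (B i)"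
        using h xyz i by (auto simp: R_def)
      have "h x i \<sqsubseteq>\<^bsub>B i\<^esub> h z i" using xyz le_trans C by (auto simp: R_def)
      moreover have "h x i \<noteq> h z i"
        using xyz le_antisym[of "h x i" "h y i"] C by (auto simp: R_def)
      ultimately show ?thesis using xyz by (simp add: R_def)
    qed
    have reflect: "\<exists>g\<in>Field ?\<kappa>. \<forall>Z e. Z \<subseteq> {z. K.leq z c} \<and> |Z| <o \<mu> \<and> K.less c e \<longrightarrow>
      (\<exists>d. K.less c d \<and> K.less d g \<and> (\<forall>z\<in>Z. \<forall>i\<in>I. R i z d \<longleftrightarrow> R i z e))"
      if c: "c \<in> Field ?\<kappa>" for c
    proof -
      let ?C = "{z. K.leq z c}"
      have "|?C| \<le>o ?\<nu>"
        using K.card_below_eq[OF c] cardSuc_ordLeq_ordLess[OF conjunct2[OF nu(1)] card_of_Card_order]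
        by blast
      then have "|?C| \<le>o |Field ?\<nu>|"
        using card_of_Field_ordIso[of ?\<nu>] nu(1) ordIso_symmetric ordLeq_ordIso_trans by blast
      \<comment> \<open>The cover \<open>W\<close> at \<open>?\<nu>\<close> is pulled back along
        \<open>u\<close> to the segment up to \<open>c\<close>.\<close>
      then obtain u where u: "inj_on u ?C" "u ` ?C \<subseteq> Field ?\<nu>"
        unfolding card_of_ordLeq[symmetric] by blast
      show ?thesis
      proof (rule K.types_reflect[OF I c, of "Field ?\<nu>" "\<lambda>e. {z \<in> ?C. u z \<in> W e}"])
        show "|Field ?\<nu>| <o ?\<kappa>"
          using card_of_Field_ordIso[of ?\<nu>] nu(1) nu_kappa ordIso_ordLess_trans by blast
        show "|{z \<in> ?C. u z \<in> W e}| <o \<mu>" if "e \<in> Field ?\<nu>" for e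
        proof -
          have "|{z \<in> ?C. u z \<in> W e}| \<le>o |W e|"
            by (intro card_of_ordLeqI[of u] inj_on_subset[OF u(1)]) auto
          then show ?thesis using W(1) that ordLeq_ordLess_trans by blast
        qed
        fix Z assume Z: "Z \<subseteq> ?C" "|Z| <o \<mu>"
        have "u ` Z \<subseteq> Field ?\<nu>" using Z(1) u(2) by blast
        moreover have "|u ` Z| <o \<mu>" using card_of_image Z(2) by (rule ordLeq_ordLess_trans)
        ultimately obtain e where "e \<in> Field ?\<nu>" "u ` Z \<subseteq> W e" using W(2) by blast
        then show "\<exists>e\<in>Field ?\<nu>. Z \<subseteq> {z \<in> ?C. u z \<in> W e}" using Z(1) by blast
      qed
    qed
    have "\<exists>i\<in>I. \<exists>S\<subseteq>Field ?\<kappa>. |S| =o ?\<kappa> \<and> (\<forall>x\<in>S. \<forall>y\<in>S. K.less x y \<longrightarrow> R i x y)"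
    proof (rule K.homogeneous_chain[where R = R, OF I _ F])
    qed (fact reflect edge trans)+
    then obtain i S where i: "i \<in> I" and S: "S \<subseteq> Field ?\<kappa>" "|S| =o ?\<kappa>"
      and chain: "\<forall>x\<in>S. \<forall>y\<in>S. K.less x y \<longrightarrow> R i x y"
      by (elim bexE exE conjE)
    \<comment> \<open>One comparable pair is enough to read off the depth bound from
      \<open>R\<close>.\<close>
    have "\<exists>x\<in>S. \<exists>y\<in>S. K.less x y"
    proof (rule ccontr)
      assume no: "\<not> ?thesis"
      have "infinite S"
        using K.inf card_of_ordIso_finite_Field[OF K.Card ordIso_symmetric[OF S(2)]] by blast
      then obtain x where x: "x \<in> S" by fastforce
      have "y = x" if "y \<in> S" for y
        using no x that S(1) K.less_linear[of x y] by (auto dest: subsetD)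
      then have "S \<subseteq> {x}" by blast
      then show False using \<open>infinite S\<close> finite_subset by blast
    qed
    then have depth: "Depth (B i) \<le>o \<chi>" using chain by (auto simp: R_def)
    interpret L: boolean_lattice "B i" using BL[OF i] .
    have carr: "(\<lambda>x. h x i) ` S \<subseteq> carrier (B i)"
    proof
      fix y assume "y \<in> (\<lambda>x. h x i) ` S"
      then obtain x where x: "x \<in> Field ?\<kappa>" "y = h x i" using S(1) by blast
      show "y \<in> carrier (B i)" using PiE_mem[OF conjunct1[OF bspec[OF h x(1)]] i] x(2) by simp
    qed
    have mono: "h x i \<sqsubseteq>\<^bsub>B i\<^esub> h y i \<and> h x i \<noteq> h y i" if "x \<in> S" "y \<in> S" "K.less x y" for x y
      using chain that by (simp add: R_def)
    have wo_S: "well_ordered_in (B i) ((\<lambda>x. h x i) ` S)" "inj_on (\<lambda>x. h x i) S"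
      by (rule K.well_ordered_in_image[OF L.partial_order_axioms S(1) carr], rule mono, assumption+)+
    have "|S| =o |(\<lambda>x. h x i) ` S|" 
      by (rule card_of_ordIsoI[OF inj_on_imp_bij_betw[OF wo_S(2)]])
    then have "|S| \<le>o Depth (B i)" using Depth_upper[OF wo_S(1)] by (rule ordIso_ordLeq_trans)
    then have "?\<kappa> \<le>o \<chi>"
      using S(2) depth ordIso_symmetric ordIso_ordLeq_trans ordLeq_transitive by blast
    then show False
      using ordLess_transitive[OF chi_nu nu_kappa] not_ordLess_ordLeq by blast
  qed
qed

text \<open>As \<open>D\<close> is an ultrafilter, the depths are otherwise above
  \<open>\<chi>\<close> almost everywhere, so at least \<open>cardSuc \<chi>\<close> there;
  \<open>card_ultraproduct_ge\<close> then gives more than \<open>\<chi>\<close> elements in the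
  ultraproduct of the depths.\<close>

lemma Depth_ultraproduct_le_card_ultraproduct:
  fixes B :: "'i \<Rightarrow> 'b gorder" and \<chi> :: "'l rel" and \<mu> :: "'m rel"
  assumes D: "ultrafilter_on I D" and BL: "\<And>i. i \<in> I \<Longrightarrow> boolean_lattice (B i)"
    and sc: "strongly_compact TYPE(('i \<Rightarrow> 'b) set set set) \<mu>"
    and I: "|I| <o \<mu>" and chi: "Cinfinite \<chi>" "\<mu> \<le>o \<chi>"
    and card: "|ultraproduct_set I D (\<lambda>i. Field (Depth (B i)))| \<le>o \<chi>"
  shows "Depth (ultraproduct I D B) \<le>o cardSuc \<chi>"
proof (rule Depth_ultraproduct_le[OF D BL sc I chi], assumption, rule ccontr)
  let ?P = "ultraproduct_set I D (\<lambda>i. Field (Depth (B i)))"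
  have F: "filter_on I D" using D by (simp add: ultrafilter_on_def)
  let ?S = "Field (cardSuc \<chi>)"
  have suc: "|?S| =o cardSuc \<chi>" "\<chi> <o cardSuc \<chi>"
    using chi(1) by (simp_all add: card_of_Field_ordIso cardSuc_Card_order cardSuc_greater)
  assume "{i \<in> I. Depth (B i) \<le>o \<chi>} \<notin> D"
  then have "I - {i \<in> I. Depth (B i) \<le>o \<chi>} \<in> D"
    using D Collect_subset[of "I" "\<lambda>i. Depth (B i) \<le>o \<chi>"] unfolding ultrafilter_on_def by blast
  moreover have "I - {i \<in> I. Depth (B i) \<le>o \<chi>} = {i \<in> I. \<not> Depth (B i) \<le>o \<chi>}"
    by blast
  ultimately have "{i \<in> I. \<not> Depth (B i) \<le>o \<chi>} \<in> D" by simp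
  then have "{i \<in> I. |?S| \<le>o |Field (Depth (B i))| } \<in> D"
  proof (rule filter_on_mono[OF F])
    fix i assume "\<not> Depth (B i) \<le>o \<chi>"
    then have "\<chi> <o Depth (B i)"
      using Card_order_not_ordLeq[OF Card_order_Depth conjunct2[OF chi(1)]] by blast
    then have "cardSuc \<chi> \<le>o Depth (B i)" using cardSuc_least[of \<chi>] chi(1) Card_order_Depth by blast
    then show "|?S| \<le>o |Field (Depth (B i))|" by (rule card_of_mono2)
  qed
  then have "|?S| \<le>o |?P|"
    by (intro card_ultraproduct_ge[OF F Field_Depth_nonempty[OF BL]])
  then have "cardSuc \<chi> \<le>o \<chi>"
    using suc(1) card ordIso_symmetric ordIso_ordLeq_trans ordLeq_transitive by blast
  then show False using suc(2) not_ordLess_ordLeq by blast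
qed

text \<open>Strong compactness is assumed at the type that holds the codes of small subsets of a
  chain in the ultraproduct, as in \<open>extends_small_subsets\<close>.\<close>

theorem mainTheorem3:
  fixes \<theta> :: "'i rel" and \<mu> :: "'m rel" and lam :: "'l rel"
    and B :: "'i \<Rightarrow> 'b gorder" and D :: "'i set set"
  assumes "Cinfinite \<theta>" and "Cinfinite \<mu>" and "Cinfinite lam"
    and "\<And>i. i \<in> Field \<theta> \<Longrightarrow> boolean_lattice (B i)"
    and "ultrafilter_on (Field \<theta>) D"
    and a: "\<theta> <o \<mu>" "\<mu> <o lam"
    and b: "strongly_compact TYPE(('i \<Rightarrow> 'b) set set set) \<mu>"
    and c: "\<And>i. i \<in> Field \<theta> \<Longrightarrow> Depth (B i) \<le>o lam"
    and d: "uniform_on (Field \<theta>) D"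
    and e: "lam +c |ultraproduct_set (Field \<theta>) D (\<lambda>i. Field (Depth (B i)))|
              <o Depth (ultraproduct (Field \<theta>) D B)"
  shows "Depth (ultraproduct (Field \<theta>) D B) =o cardSuc lam \<and>
         |ultraproduct_set (Field \<theta>) D (\<lambda>i. Field (Depth (B i)))| =o lam"
proof
  let ?P = "ultraproduct_set (Field \<theta>) D (\<lambda>i. Field (Depth (B i)))"
  let ?d = "Depth (ultraproduct (Field \<theta>) D B)"
  note BL = assms(4) and D = assms(5)
  have F: "filter_on (Field \<theta>) D" using D by (simp add: ultrafilter_on_def)
  have lam: "Card_order lam" and theta: "Card_order \<theta>" and mu: "Card_order \<mu>" using assms(1-3) by simp_all
  have I: "|Field \<theta>| <o \<mu>"
    using card_of_Field_ordIso[OF theta] a(1) by (rule ordIso_ordLess_trans)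
  have up: "?d \<le>o cardSuc lam"
    using Depth_ultraproduct_le[OF D BL b I assms(3) ordLess_imp_ordLeq[OF a(2)] filter_on_all[OF F c]] .
  have "lam <o ?d" using ordLeq_csum1[OF lam] e by (rule ordLeq_ordLess_trans)
  then have "cardSuc lam \<le>o ?d" using cardSuc_least[OF lam Card_order_Depth] by blast
  then show "?d =o cardSuc lam" using up by (simp add: ordIso_iff_ordLeq)
  have P_less: "|?P| <o ?d" using ordLeq_csum2[OF card_of_Card_order] e by (rule ordLeq_ordLess_trans)
  then have P_le: "|?P| \<le>o lam"
    using cardSuc_ordLeq_ordLess[OF lam card_of_Card_order, of ?P] up ordLess_ordLeq_trans by blast
  have "lam \<le>o |?P|"
  proof (rule ccontr)
    assume "\<not> lam \<le>o |?P|"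
    then have P_lam: "|?P| <o lam"
      using Card_order_not_ordLeq[OF lam card_of_Card_order] by blast
    have "?d \<le>o lam"
    \<comment> \<open>The bound \<open>\<chi>\<close> is the larger of \<mu> and the cardinality of
      \<open>?P\<close>. Both are below \<open>lam\<close>, so the successor of
      \<open>\<chi>\<close> is at most \<open>lam\<close>.\<close>
    proof (cases "|?P| \<le>o \<mu>")
      case True
      then have "?d \<le>o cardSuc \<mu>"
        using Depth_ultraproduct_le_card_ultraproduct[where B = B, OF D BL b I assms(2) ordLeq_refl[OF mu]] by blast
      moreover have "cardSuc \<mu> \<le>o lam" using cardSuc_least[OF mu lam a(2)] .
      ultimately show ?thesis by (rule ordLeq_transitive)
    next
      case False
      then have mu_P: "\<mu> \<le>o |?P|"
        using Card_order_not_ordLeq[OF card_of_Card_order mu] ordLess_imp_ordLeq by blast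
      have "Cinfinite |?P|" using cinfinite_mono[OF mu_P] assms(2) by (simp add: card_of_Card_order)
      then have "?d \<le>o cardSuc |?P|"
        using Depth_ultraproduct_le_card_ultraproduct[where B = B, OF D BL b I _ mu_P]
          ordLeq_refl[OF card_of_Card_order] by blast
      moreover have "cardSuc |?P| \<le>o lam" using cardSuc_least[OF card_of_Card_order lam P_lam] .
      ultimately show ?thesis by (rule ordLeq_transitive)
    qed
    then show False using \<open>lam <o ?d\<close> not_ordLess_ordLeq by blast
  qed
  then show "|?P| =o lam" using P_le by (simp add: ordIso_iff_ordLeq)
qed

end
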